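(* Let the associated leader satellite be equipped with $N_{\mathrm F}$ follower satellites and let $$P_{\mathrm{out}}^{\mathrm{Cluster}}=\mathbb{P}\left(\mathrm{SNR}_{\mathrm{LU}}<\gamma_{\mathrm{th}}\ \text{and}\ \mathrm{SNR}_{\mathrm{FU},i}<\gamma_{\mathrm{th}}\text{ for all }i=1,\dots,N_{\mathrm F}\right)$$ be the outage probability of the cluster, i.e. the probability that the SNR received by the user from all satellites in the cluster is below $\gamma_{\mathrm{th}}$. Then $$P_{\mathrm{out}}^{\mathrm{Cluster}}=\int_0^{\theta_{\max}}\left(P_{\mathrm{out},i}^{\mathrm{FU}}(\theta)\right)^{N_{\mathrm F}}P_{\mathrm{Cond}}^{\mathrm{LU}}(\theta)\,f_{\theta_{\mathrm{LU}}}(\theta)\,\mathrm d\theta,$$ where $f_{\theta_{\mathrm{LU}}}(\theta)=\frac{N_{\mathrm L}\sin\theta}{2}\left(\frac{1+\cos\theta}{2}\right)^{N_{\mathrm L}-1}$, $0\le\theta\le\theta_{\max}$, is the PDF of the contact angle $\theta_{\mathrm{LU}}$; the conditional outage probability of the leader given $\theta_{\mathrm{LU}}=\theta$ is $$P_{\mathrm{Cond}}^{\mathrm{LU}}(\theta)=F_{W_{\mathrm U}}\left(\frac{\gamma_{\mathrm{th}}r_{\mathrm{LU}}^2(\theta)}{\xi_{\mathrm{LU}}}\right),\qquad r_{\mathrm{LU}}(\theta)=\sqrt{R_{\mathrm{sat}}^2+R_\oplus^2-2R_{\mathrm{sat}}R_\oplus\cos\theta};$$ and the outage probability of the link from the $i$-th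 follower to the user given $\theta_{\mathrm{LU}}=\theta$ (the same for every $i$) is $$P_{\mathrm{out},i}^{\mathrm{FU}}(\theta)=\int_0^{2\pi}\int_0^{\theta_{\mathrm{cap}}}\frac{\sin\psi}{2\pi(1-\cos\theta_{\mathrm{cap}})}F_{W_{\mathrm U}}\left(\frac{\gamma_{\mathrm{th}}r_{\mathrm{FU}}^2(\theta,\psi,\varphi)}{\xi_{\mathrm{FU}}}\right)\mathrm d\psi\,\mathrm d\varphi,$$ with $r_{\mathrm{FU}}$ the Euclidean distance between the follower and the user, $$r_{\mathrm{FU}}(\theta,\psi,\varphi)=\left(R_\oplus^2+R_{\mathrm{sat}}^2-2R_\oplus R_{\mathrm{sat}}(\sin\theta\sin\psi\cos\varphi+\cos\theta\cos\psi)\right)^{1/2}.$$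
   Context: Geometry: $R_\oplus>0$ is the Earth radius, $h_{\mathrm{sat}}>0$ the satellite altitude, $R_{\mathrm{sat}}=R_\oplus+h_{\mathrm{sat}}$. The user is a fixed point on the sphere of radius $R_\oplus$ centred at the Earth's centre $O$. $N_{\mathrm L}\ge1$ leader satellites are i.i.d. uniformly distributed on the sphere of radius $R_{\mathrm{sat}}$ centred at $O$ (homogeneous binomial point process). The central angle between two devices is the angle at $O$ between the segments joining $O$ to them. The associated leader is the leader nearest to the user, and the contact angle $\theta_{\mathrm{LU}}$ is the central angle between it and the user. Its $N_{\mathrm F}\ge1$ followers are, given the leader positions, i.i.d. uniformly distributed (homogeneous binomial point process) on the spherical cap of the sphere of radius $R_{\mathrm{sat}}$ consisting of all points whose central angle to the associated leader is at most $\theta_{\mathrm{cap}}>0$; $\psi$ and $\varphi$ are the polar and azimuth angles of a follower about the axis through the associated leader. $\theta_{\max}$ is the maximum central angle between a leader satellite and the user (corresponding to the maximum communication distance), with $\theta_{\max}\le\arccos(R_\oplus/R_{\mathrm{sat}})-\theta_{\mathrm{cap}}$. The contact angle is taken to range over $0\le\theta_{\mathrm{LU}}\le\theta_{\max}$, with the PDF $f_{\theta_{\mathrm{LU}}}$ displayed in the claim on that range. Channel: $\mathrm{SNR}_{\mathrm{LU}}=\xi_{\mathrm{LU}}W_{\mathrm{U},0}/r_{\mathrm{LU}}^2$ and $\mathrm{SNR}_{\mathrm{FU},i}=\xi_{\mathrm{FU}}W_{\mathrm{U},i}/r_{\mathrm{FU},i}^2$, where $r_{\mathrm{LU}}$ and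 $r_{\mathrm{FU},i}$ are the Euclidean distances from the user to the associated leader and to the $i$-th follower, and $\xi_{Q\mathrm U}=\rho_{Q\mathrm U}G_{Q\mathrm U}\zeta_{\mathrm U}\left(\frac{\nu_{Q\mathrm U}}{4\pi\sigma_{\mathrm U}}\right)^2$ for $Q\in\{\mathrm L,\mathrm F\}$ are positive constants (transmit power $\rho$, antenna gain $G$, rain attenuation $\zeta_{\mathrm U}$, wavelength $\nu$, noise power $\sigma_{\mathrm U}^2$). The fading powers $W_{\mathrm U,0},\dots,W_{\mathrm U,N_{\mathrm F}}\ge0$ are independent of each other and of all positions, each with the shadowed-Rician CDF (parameters $\Omega,b_0,m>0$) $$F_{W_{\mathrm U}}(w)=\left(\frac{2b_0m}{2b_0m+\Omega}\right)^m\sum_{z=0}^\infty\frac{(m)_z}{z!\,\Gamma(z+1)}\left(\frac{\Omega}{2b_0m+\Omega}\right)^z\int_0^{w/(2b_0)}t^ze^{-t}\,\mathrm dt,\quad w\ge0,$$ with $(m)_z$ the Pochhammer symbol. $\gamma_{\mathrm{th}}>0$ is the predefined coverage threshold.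
   Formalization: The outage probability is taken of the event that the contact angle is at most θ_max and all SNRs are below γ_th; without this restriction the formula fails, since for leaders uniform on the whole sphere the contact angle exceeds θ_max with positive probability. *)

theory Defs
  imports "HOL-Probability.Probability"
begin

definition central_angle :: "real^3 \<Rightarrow> real^3 \<Rightarrow> real" where
  "central_angle x y = arccos ((x \<bullet> y) / (norm x * norm y))"

text \<open>The normalised surface measure of a sphere centred at the origin, in its cone-measure form:
  the mass of a Borel part of the sphere is the relative volume of the cone over it, so it is the
  law of the radial projection of a uniform point of the unit ball.\<close>

definition uniform_sphere :: "real \<Rightarrow> (real^3) measure" where
  "uniform_sphere R = distr (uniform_measure lborel (ball 0 1)) borel (\<lambda>x. R *\<^sub>R sgn x)"

definition spherical_cap :: "real \<Rightarrow> real^3 \<Rightarrow> real \<Rightarrow> (real^3) set" where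
  "spherical_cap R c \<alpha> = {x \<in> sphere 0 R. central_angle c x \<le> \<alpha>}"

definition uniform_cap :: "real \<Rightarrow> real^3 \<Rightarrow> real \<Rightarrow> (real^3) measure" where
  "uniform_cap R c \<alpha> = uniform_measure (uniform_sphere R) (spherical_cap R c \<alpha>)"

text \<open>The conditional probability of the event \<open>E\<close> given the \<open>N\<close>-valued random variable \<open>Y\<close>,
  i.e.\ given the sigma-algebra generated by \<open>Y\<close>.\<close>

definition cond_prob_rv ::
    "'a measure \<Rightarrow> 'b measure \<Rightarrow> ('a \<Rightarrow> 'b) \<Rightarrow> 'a set \<Rightarrow> 'a \<Rightarrow> real" where
  "cond_prob_rv M N Y E =
     real_cond_exp M (vimage_algebra (space M) Y N) (indicator E :: 'a \<Rightarrow> real)"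

text \<open>Given \<open>Y\<close>, the \<open>X i\<close> with \<open>i \<in> I\<close> are independent, each with law \<open>K \<omega>\<close>; here \<open>K\<close> is
  intended to depend on \<open>\<omega>\<close> only through \<open>Y \<omega>\<close>.\<close>

definition cond_iid_given ::
    "'a measure \<Rightarrow> 'b measure \<Rightarrow> ('a \<Rightarrow> 'b) \<Rightarrow> 'i set \<Rightarrow> ('i \<Rightarrow> 'a \<Rightarrow> real^3)
      \<Rightarrow> ('a \<Rightarrow> (real^3) measure) \<Rightarrow> bool" where
  "cond_iid_given M N Y I X K \<longleftrightarrow>
     (\<forall>i\<in>I. X i \<in> borel_measurable M) \<and>
     (\<forall>C. (\<forall>i\<in>I. C i \<in> sets borel) \<longrightarrow>
        (AE \<omega> in M. cond_prob_rv M N Y {\<omega>' \<in> space M. \<forall>i\<in>I. X i \<omega>' \<in> C i} \<omega>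
                    = (\<Prod>i\<in>I. measure (K \<omega>) (C i))))"

text \<open>Unlike \<open>indep_var\<close>, this allows the two random variables to have different types.\<close>

definition indep_rvs ::
    "'a measure \<Rightarrow> 'b measure \<Rightarrow> ('a \<Rightarrow> 'b) \<Rightarrow> 'c measure \<Rightarrow> ('a \<Rightarrow> 'c) \<Rightarrow> bool" where
  "indep_rvs M N Y N' Y' \<longleftrightarrow>
     Y \<in> measurable M N \<and> Y' \<in> measurable M N' \<and>
     prob_space.indep_set M (sets (vimage_algebra (space M) Y N))
                            (sets (vimage_algebra (space M) Y' N'))"

definition leader_positions ::
    "nat \<Rightarrow> (nat \<Rightarrow> 'a \<Rightarrow> real^3) \<Rightarrow> 'a \<Rightarrow> nat \<Rightarrow> real^3" where
  "leader_positions N L \<omega> = (\<lambda>j\<in>{1..N}. L j \<omega>)"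

text \<open>Ties, which have probability zero, are broken arbitrarily.\<close>

definition associated_leader ::
    "nat \<Rightarrow> (nat \<Rightarrow> 'a \<Rightarrow> real^3) \<Rightarrow> real^3 \<Rightarrow> 'a \<Rightarrow> real^3" where
  "associated_leader N L u \<omega> = L (arg_min_on (\<lambda>j. dist (L j \<omega>) u) {1..N}) \<omega>"

definition contact_angle ::
    "nat \<Rightarrow> (nat \<Rightarrow> 'a \<Rightarrow> real^3) \<Rightarrow> real^3 \<Rightarrow> 'a \<Rightarrow> real" where
  "contact_angle N L u \<omega> = central_angle (associated_leader N L u \<omega>) u"

text \<open>Transmit power \<open>\<rho>\<close>, antenna gain \<open>G\<close>, rain attenuation \<open>\<zeta>\<close>, wavelength \<open>\<nu>\<close>,
  noise power \<open>\<sigma>\<^sup>2\<close>.\<close>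

definition link_const :: "real \<Rightarrow> real \<Rightarrow> real \<Rightarrow> real \<Rightarrow> real \<Rightarrow> real" where
  "link_const \<rho> G \<zeta> \<nu> \<sigma> = \<rho> * G * \<zeta> * (\<nu> / (4 * pi * \<sigma>))\<^sup>2"

definition snr :: "real \<Rightarrow> real \<Rightarrow> real \<Rightarrow> real" where
  "snr \<xi> w r = \<xi> * w / r\<^sup>2"

definition shadowed_rician_cdf :: "real \<Rightarrow> real \<Rightarrow> real \<Rightarrow> real \<Rightarrow> real" where
  "shadowed_rician_cdf \<Omega> b0 m w =
     ((2 * b0 * m) / (2 * b0 * m + \<Omega>)) powr m *
     (\<Sum>z. pochhammer m z / (fact z * Gamma (real z + 1)) * (\<Omega> / (2 * b0 * m + \<Omega>)) ^ z *
           (LBINT t=0..ereal (w / (2 * b0)). t ^ z * exp (- t)))"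

definition contact_angle_pdf :: "nat \<Rightarrow> real \<Rightarrow> real" where
  "contact_angle_pdf N \<theta> = real N * sin \<theta> / 2 * ((1 + cos \<theta>) / 2) ^ (N - 1)"

definition r_LU :: "real \<Rightarrow> real \<Rightarrow> real \<Rightarrow> real" where
  "r_LU R_earth R_sat \<theta> = sqrt (R_sat\<^sup>2 + R_earth\<^sup>2 - 2 * R_sat * R_earth * cos \<theta>)"

definition r_FU :: "real \<Rightarrow> real \<Rightarrow> real \<Rightarrow> real \<Rightarrow> real \<Rightarrow> real" where
  "r_FU R_earth R_sat \<theta> \<psi> \<phi> =
     sqrt (R_earth\<^sup>2 + R_sat\<^sup>2
           - 2 * R_earth * R_sat * (sin \<theta> * sin \<psi> * cos \<phi> + cos \<theta> * cos \<psi>))"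

definition P_Cond_LU ::
    "(real \<Rightarrow> real) \<Rightarrow> real \<Rightarrow> real \<Rightarrow> real \<Rightarrow> real \<Rightarrow> real \<Rightarrow> real" where
  "P_Cond_LU F \<gamma> \<xi> R_earth R_sat \<theta> = F (\<gamma> * (r_LU R_earth R_sat \<theta>)\<^sup>2 / \<xi>)"

definition P_out_FU ::
    "(real \<Rightarrow> real) \<Rightarrow> real \<Rightarrow> real \<Rightarrow> real \<Rightarrow> real \<Rightarrow> real \<Rightarrow> real \<Rightarrow> real" where
  "P_out_FU F \<gamma> \<xi> R_earth R_sat \<theta>_cap \<theta> =
     (LBINT \<phi>=0..ereal (2 * pi). (LBINT \<psi>=0..ereal \<theta>_cap.
        sin \<psi> / (2 * pi * (1 - cos \<theta>_cap)) *
        F (\<gamma> * (r_FU R_earth R_sat \<theta> \<psi> \<phi>)\<^sup>2 / \<xi>)))"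

end

theory Submission
  imports Defs
begin

text \<open>Uniform points on the sphere and on its caps are described in spherical coordinates about an
  arbitrary axis by a change of variables in the unit ball; the formula for the follower outage then
  appears as an integral over a cap, and the height of a uniform point is uniform, which gives the
  law of the contact angle as that of a minimum of independent angles.

  Given all fading powers, the outage event merely constrains each position to lie in some Borel
  set, so the conditional independence of the followers, which is stated for products of sets only,
  applies as it is. Integrating over the fading afterwards and exchanging the integrals turns the
  product of cap probabilities into the product of the link outage probabilities.\<close>

subsection \<open>The shadowed-Rician distribution function\<close>

text \<open>Two features of the claim shape the proof. It conditions on the contact angle, while the
  model conditions on all leader positions; the passage works because the average over a cap of a
  function of the distance to the user depends on the cap centre only through its central angle to
  the user. And outage is a strict inequality, while \<open>fading_cdf\<close> gives the probability
  of a non-strict one; the two agree because the shadowed-Rician series is continuous, so that the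
  fading has no atom at a positive level.

  All four claims come from one identity, \<open>emeasure_outage\<close>, in which a Borel set
  \<open>B\<close> of contact angles and a set \<open>J\<close> of links are free; the leader is
  link 0. All links give the cluster formula, no link gives the law of the contact angle, and a
  single link, tested against every \<open>B\<close>, gives the conditional outage
  probabilities.\<close>

definition exp_partial_sum :: "nat \<Rightarrow> real \<Rightarrow> real" where
  "exp_partial_sum z x = (\<Sum>k\<le>z. x ^ k / fact k)"

text \<open>Differentiating the truncated series removes its top term, so in the product with exp (-
  x) everything cancels except that term. The antiderivative is minus the upper incomplete gamma
  function at z + 1.\<close>

lemma lower_gamma_antiderivative:
  "((\<lambda>x. - (fact z * (exp (- x) * exp_partial_sum z x))) has_real_derivative x ^ z * exp (- x)) (at x within S)"
proof -
  have D: "((\<lambda>x. exp_partial_sum z x) has_real_derivative exp_partial_sum z x - x ^ z / fact z) (at x within S)" for z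
  proof (induction z)
    case (Suc z)
    have "((\<lambda>x. exp_partial_sum z x + x ^ Suc z / fact (Suc z)) has_real_derivative
        (exp_partial_sum z x - x ^ z / fact z) + (real (Suc z) * x ^ z) / fact (Suc z)) (at x within S)"
      using DERIV_pow[of "Suc z" x S] by (intro derivative_intros Suc.IH DERIV_cdivide) simp
    then show ?case by (simp add: exp_partial_sum_def)
  qed (simp add: exp_partial_sum_def)
  show ?thesis
    by (rule derivative_eq_intros D refl | simp)+ (simp add: algebra_simps)
qed

lemma lower_gamma_integral:
  "(LBINT t=0..ereal x. t ^ z * exp (- t)) = fact z * (1 - exp (- x) * exp_partial_sum z x)"
proof -
  have "(LBINT t=ereal 0..ereal x. t ^ z * exp (- t)) =
      - (fact z * (exp (- x) * exp_partial_sum z x)) - (- (fact z * (exp (- 0) * exp_partial_sum z 0)))"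
    by (rule interval_integral_FTC_finite)
       (auto intro!: continuous_intros simp: has_real_derivative_iff_has_vector_derivative[symmetric]
         intro: lower_gamma_antiderivative)
  moreover have "exp_partial_sum z 0 = 1"
    by (simp add: exp_partial_sum_def power_0_left sum.delta if_distrib[of "\<lambda>x. x / _"] cong: if_cong)
  ultimately show ?thesis by (simp add: zero_ereal_def algebra_simps)
qed

text \<open>Once the integrals are evaluated, the coefficients are those of the binomial series of
  (1 - q) powr (- m), multiplied by functions bounded by 1 on the nonnegative axis; since q < 1, the
  Weierstrass test applies. Continuity serves both measurability and the exclusion of atoms.\<close>

lemma continuous_on_shadowed_rician_cdf:
  assumes "\<Omega> > 0" "b0 > 0" "m > 0"
  shows "continuous_on {0..} (shadowed_rician_cdf \<Omega> b0 m)"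
proof -
  define q where "q = \<Omega> / (2 * b0 * m + \<Omega>)"
  have d: "0 < 2 * b0 * m + \<Omega>" using assms by (simp add: add_pos_pos)
  have q: "0 \<le> q" "q < 1" using assms d by (auto simp: q_def)
  define e where "e = (\<lambda>z x. 1 - exp (- x) * exp_partial_sum z x)"
  define a where "a = (\<lambda>z. pochhammer m z / fact z * q ^ z)"
  \<comment> \<open>The generalised binomial theorem with exponent - m and argument - q; the two
    alternating signs cancel below.\<close>
  have "summable (\<lambda>z. (- m gchoose z) * (- q) ^ z)"
    using gen_binomial_real[of "- q" "- m"] q by (auto simp: sums_iff)
  also have "(\<lambda>z. (- m gchoose z) * (- q) ^ z) = a"
  proof
    fix z
    have "(- m gchoose z) * (- q) ^ z = ((- 1) ^ z * (- 1) ^ z) * (pochhammer m z / fact z * q ^ z)"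
      unfolding gbinomial_pochhammer by (subst power_minus) simp
    then show "(- m gchoose z) * (- q) ^ z = a z"
      by (simp add: a_def power_mult_distrib[symmetric])
  qed
  finally have sum_a: "summable a" .
  have a0: "0 \<le> a z" for z using q assms by (simp add: a_def pochhammer_nonneg)
  have e: "\<bar>e z x\<bar> \<le> 1" if "0 \<le> x" for z x
  proof -
    have "exp_partial_sum z x \<le> exp x"
      using sum_le_suminf[OF summable_exp_generic[of x], of "{..z}"] that
      by (simp add: exp_partial_sum_def exp_def scaleR_conv_of_real divide_inverse mult.commute)
    then have "exp (- x) * exp_partial_sum z x \<le> exp (- x) * exp x" by (intro mult_left_mono) auto
    moreover have "0 \<le> exp_partial_sum z x" using that by (simp add: exp_partial_sum_def sum_nonneg)
    ultimately show ?thesis by (simp add: e_def exp_minus)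
  qed
  have "continuous_on {0..} (\<lambda>w. \<Sum>z. a z * e z (w / (2 * b0)))"
  proof (rule uniform_limit_theorem)
    show "uniform_limit {0..} (\<lambda>n w. \<Sum>z<n. a z * e z (w / (2 * b0))) (\<lambda>w. \<Sum>z. a z * e z (w / (2 * b0))) sequentially"
    proof (rule Weierstrass_m_test[OF _ sum_a])
      fix n and w :: real assume "w \<in> {0..}"
      then have "\<bar>e n (w / (2 * b0))\<bar> \<le> 1" using assms by (intro e) auto
      then show "norm (a n * e n (w / (2 * b0))) \<le> a n"
        using a0[of n] by (simp add: abs_mult mult_left_le)
    qed
    show "\<forall>\<^sub>F n in sequentially. continuous_on {0..} (\<lambda>w. \<Sum>z<n. a z * e z (w / (2 * b0)))"
      unfolding e_def exp_partial_sum_def using assms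
      by (intro always_eventually allI continuous_intros) auto
  qed simp
  moreover have "shadowed_rician_cdf \<Omega> b0 m w = ((2 * b0 * m) / (2 * b0 * m + \<Omega>)) powr m * (\<Sum>z. a z * e z (w / (2 * b0)))" for w
  proof -
    \<comment> \<open>This factorial cancels the one produced by
      \<open>lower_gamma_integral\<close>, which leaves the single factorial in
      \<open>a\<close>.\<close>
    have "Gamma (real z + 1) = fact z" for z using Gamma_fact[of z, where 'a = real] by (simp add: add.commute)
    then have "pochhammer m z / (fact z * Gamma (real z + 1)) * q ^ z * (fact z * X) = a z * X" for z X
      by (simp add: a_def)
    then show ?thesis
      unfolding shadowed_rician_cdf_def lower_gamma_integral q_def[symmetric] e_def by simp
  qed
  ultimately show ?thesis by (simp add: continuous_on_mult_left)
qed

subsection \<open>Spherical coordinates\<close>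

text \<open>The azimuth comes first to agree with \<open>P_out_FU\<close>, where the azimuth
  integral is the outer one. The pole, axis 3, is what \<open>ex_orthogonal_frame\<close> later
  sends to the direction of the cap centre.\<close>

definition polar_direction :: "real \<Rightarrow> real \<Rightarrow> real^3" where
  "polar_direction \<phi> \<psi> = vector [sin \<psi> * cos \<phi>, sin \<psi> * sin \<phi>, cos \<psi>]"

lemma polar_direction_nth [simp]:
  "polar_direction \<phi> \<psi> $ 1 = sin \<psi> * cos \<phi>"
  "polar_direction \<phi> \<psi> $ 2 = sin \<psi> * sin \<phi>"
  "polar_direction \<phi> \<psi> $ 3 = cos \<psi>"
  by (simp_all add: polar_direction_def)

lemma norm_polar_direction [simp]: "norm (polar_direction \<phi> \<psi>) = 1"
proof -
  have "(sin \<psi> * cos \<phi>)\<^sup>2 + (sin \<psi> * sin \<phi>)\<^sup>2 + (cos \<psi>)\<^sup>2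
      = (sin \<psi>)\<^sup>2 * ((sin \<phi>)\<^sup>2 + (cos \<phi>)\<^sup>2) + (cos \<psi>)\<^sup>2"
    by (simp only: power_mult_distrib) algebra
  then show ?thesis
    by (simp add: norm_eq_sqrt_inner inner_vec_def sum_3 power2_eq_square[symmetric])
qed

lemma continuous_on_polar_direction [continuous_intros]:
  fixes f g :: "'a::t2_space \<Rightarrow> real"
  assumes "continuous_on S f" "continuous_on S g"
  shows "continuous_on S (\<lambda>x. polar_direction (f x) (g x))"
proof -
  \<comment> \<open>Componentwise continuity speaks of \<open>vec_lambda\<close>, so the list
    notation \<open>vector\<close> is turned into a case distinction on the index.\<close>
  have "polar_direction \<phi> \<psi> = (\<chi> i. if i = 1 then sin \<psi> * cos \<phi> else if i = 2 then sin \<psi> * sin \<phi> else cos \<psi>)" for \<phi> \<psi>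
    by (simp add: vec_eq_iff forall_3)
  moreover have "continuous_on S (\<lambda>x. \<chi> i::3. if i = 1 then sin (g x) * cos (f x) else if i = 2 then sin (g x) * sin (f x) else cos (g x))"
  proof (intro continuous_on_vec_lambda)
    fix i :: 3
    show "continuous_on S (\<lambda>x. if i = 1 then sin (g x) * cos (f x) else if i = 2 then sin (g x) * sin (f x) else cos (g x))"
      using assms by (cases "i = 1"; cases "i = 2") (auto intro!: continuous_on_mult continuous_on_sin continuous_on_cos)
  qed
  ultimately show ?thesis by simp
qed

lemma measurable_vector3:
  "(\<lambda>(r, \<phi>, \<psi>). vector [r, \<phi>, \<psi>] :: real^3) \<in> borel_measurable borel"
proof -
  let ?T = "\<lambda>(r, \<phi>, \<psi>). vector [r, \<phi>, \<psi>] :: real^3"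
  have T_eq: "?T = (\<lambda>x. \<chi> i. if i = 1 then fst x else if i = 2 then fst (snd x) else snd (snd x))"
    by (auto simp: vec_eq_iff forall_3 fun_eq_iff)
  have "continuous_on UNIV ?T"
    unfolding T_eq
  proof (intro continuous_on_vec_lambda)
    fix i :: 3
    show "continuous_on UNIV (\<lambda>x::real\<times>real\<times>real. if i = 1 then fst x else if i = 2 then fst (snd x) else snd (snd x))"
      by (cases "i = 1"; cases "i = 2") (auto intro!: continuous_intros)
  qed
  then show ?thesis by (rule borel_measurable_continuous_onI)
qed

text \<open>Determinants and the change of variables formula live on \<open>real^3\<close>, iterated
  integrals on pairs; this identity lets the radius and the two angles be integrated separately.
  Both measures agree on boxes, which determines Lebesgue measure.\<close>

lemma lborel_vec3_eq_distr:
  "(lborel :: (real^3) measure) = distr lborel borel (\<lambda>(r, \<phi>, \<psi>). vector [r, \<phi>, \<psi>])"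
proof (rule lborel_eqI)
  let ?T = "\<lambda>(r, \<phi>, \<psi>). vector [r, \<phi>, \<psi>] :: real^3"
  have meas: "?T \<in> borel_measurable lborel" using measurable_vector3 by simp
  fix l u :: "real^3"
  assume le: "\<And>b. b \<in> Basis \<Longrightarrow> l \<bullet> b \<le> u \<bullet> b"
  have le': "l $ i \<le> u $ i" for i
    using le[of "axis i 1"] by (auto simp: inner_axis Basis_vec_def)
  have vim: "?T -` box l u = box (l$1, l$2, l$3) (u$1, u$2, u$3)"
    by (auto simp: mem_box_cart forall_3 mem_box Basis_prod_def ball_Un)
  have "emeasure (distr lborel borel ?T) (box l u) = emeasure lborel (box (l$1, l$2, l$3) (u$1, u$2, u$3))"
    using meas vim by (subst emeasure_distr) auto
  also have "\<dots> = ennreal (\<Prod>b\<in>Basis. ((u$1, u$2, u$3) - (l$1, l$2, l$3)) \<bullet> b)"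
    using le' by (intro emeasure_lborel_box) (auto simp: Basis_prod_def)
  also have "(\<Prod>b\<in>Basis. ((u$1, u$2, u$3) - (l$1, l$2, l$3)) \<bullet> b) = (\<Prod>i\<in>UNIV. u$i - l$i)"
  proof -
    have B: "(Basis :: (real \<times> real \<times> real) set) = {(1, 0, 0), (0, 1, 0), (0, 0, 1)}"
      by (simp add: Basis_prod_def zero_prod_def insert_commute)
    show ?thesis unfolding B UNIV_3 by (simp add: inner_prod_def)
  qed
  also have "\<dots> = (\<Prod>b\<in>Basis. (u - l) \<bullet> b)"
  proof -
    have B: "(Basis :: (real^3) set) = (\<lambda>i. axis i 1) ` UNIV" by (simp add: Basis_vec_def UNION_singleton_eq_range)
    show ?thesis
      unfolding B by (subst prod.reindex) (simp_all add: inj_on_def axis_eq_axis inner_axis)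
  qed
  finally show "emeasure (distr lborel borel ?T) (box l u) = ennreal (\<Prod>b\<in>Basis. (u - l) \<bullet> b)" .
qed simp

text \<open>The excluded plane contains both poles and the seam at azimuth 0, so the remaining
  directions have angles in open intervals. The domain of the chart can therefore be an open
  set.\<close>

lemma ex_polar_direction:
  fixes x :: "real^3"
  assumes "norm x = 1" "x $ 2 \<noteq> 0"
  obtains \<phi> \<psi> where "0 < \<phi>" "\<phi> < 2 * pi" "0 < \<psi>" "\<psi> < pi" "x = polar_direction \<phi> \<psi>"
proof -
  have sq: "(x$1)\<^sup>2 + (x$2)\<^sup>2 + (x$3)\<^sup>2 = 1"
    using assms(1) by (simp add: norm_eq_1 inner_vec_def sum_3 power2_eq_square)
  have "(x$2)\<^sup>2 > 0" using assms(2) by simp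
  then have "(x$3)\<^sup>2 < 1" using sq zero_le_power2[of "x$1"] by linarith
  then have lt: "-1 < x$3" "x$3 < 1" by (auto simp: power2_less_1_iff abs_square_less_1 abs_less_iff)
  define \<psi> where "\<psi> = arccos (x$3)"
  have \<psi>: "0 < \<psi>" "\<psi> < pi" "cos \<psi> = x$3"
    using lt arccos_lt_bounded[of "x$3"] by (auto simp: \<psi>_def)
  have sp: "sin \<psi> > 0" using \<psi> by (simp add: sin_gt_zero)
  have s2: "(sin \<psi>)\<^sup>2 = (x$1)\<^sup>2 + (x$2)\<^sup>2" using sq \<psi>(3) by (simp add: sin_squared_eq)
  have "(x$1 / sin \<psi>)\<^sup>2 + (x$2 / sin \<psi>)\<^sup>2 = 1"
    using sp by (simp add: power_divide add_divide_distrib[symmetric] s2[symmetric])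
  then obtain \<phi> where \<phi>: "0 \<le> \<phi>" "\<phi> < 2 * pi" "x$1 / sin \<psi> = cos \<phi>" "x$2 / sin \<psi> = sin \<phi>"
    by (rule sincos_total_2pi)
  have "\<phi> \<noteq> 0" using \<phi>(4) assms(2) sp by auto
  moreover have "x = polar_direction \<phi> \<psi>"
    using \<phi> \<psi> sp by (auto simp: vec_eq_iff forall_3 field_simps)
  ultimately show ?thesis using that \<phi> \<psi> by (metis less_eq_real_def)
qed

lemma polar_direction_inj:
  assumes "0 < \<phi>" "\<phi> < 2 * pi" "0 < \<psi>" "\<psi> < pi" "0 < \<phi>'" "\<phi>' < 2 * pi" "0 < \<psi>'" "\<psi>' < pi"
    and eq: "polar_direction \<phi> \<psi> = polar_direction \<phi>' \<psi>'"
  shows "\<phi> = \<phi>'" "\<psi> = \<psi>'"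
proof -
  have "cos \<psi> = cos \<psi>'" using arg_cong[OF eq, of "\<lambda>x. x$3"] by simp
  then show \<psi>: "\<psi> = \<psi>'" using cos_inj_pi[of \<psi> \<psi>'] assms by auto
  have "sin \<psi> > 0" using assms by (simp add: sin_gt_zero)
  then have "cos \<phi> = cos \<phi>'" "sin \<phi> = sin \<phi>'"
    using arg_cong[OF eq, of "\<lambda>x. x$1"] arg_cong[OF eq, of "\<lambda>x. x$2"] \<psi> by auto
  then obtain k :: int where k: "\<phi> = \<phi>' + 2 * pi * real_of_int k"
    using sin_cos_eq_iff[of \<phi> \<phi>'] by blast
  \<comment> \<open>Both azimuths lie strictly between 0 and 2 pi, so they differ by less than one
    period.\<close>
  have "2 * pi * real_of_int k < 2 * pi * 1" "2 * pi * (-1) < 2 * pi * real_of_int k"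
    using k assms by linarith+
  then have "real_of_int k < 1" "-1 < real_of_int k"
    by (simp_all only: mult_less_cancel_left_pos[of "2 * pi"] pi_gt_zero mult_pos_pos zero_less_numeral)
  then have "k = 0" by linarith
  then show "\<phi> = \<phi>'" using k by simp
qed

definition spherical_jacobian :: "real^3 \<Rightarrow> real^3^3" where
  "spherical_jacobian x = vector
    [vector [sin (x$3) * cos (x$2), - (x$1 * sin (x$3) * sin (x$2)), x$1 * cos (x$3) * cos (x$2)],
     vector [sin (x$3) * sin (x$2), x$1 * sin (x$3) * cos (x$2), x$1 * cos (x$3) * sin (x$2)],
     vector [cos (x$3), 0, - (x$1 * sin (x$3))]]"

text \<open>The sign is negative because the order radius, azimuth, polar angle reverses
  orientation; only the absolute value enters the change of variables.\<close>

lemma det_spherical_jacobian: "det (spherical_jacobian x) = - ((x$1)\<^sup>2 * sin (x$3))"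
proof -
  have a: "(sin t)\<^sup>2 = 1 - (cos t)\<^sup>2" for t :: real by (simp add: sin_squared_eq)
  have "det (spherical_jacobian x) = - ((x$1)\<^sup>2 * sin (x$3)) * ((sin (x$3))\<^sup>2 + (cos (x$3))\<^sup>2) * ((sin (x$2))\<^sup>2 + (cos (x$2))\<^sup>2)"
    unfolding det_3 spherical_jacobian_def vector_3 by algebra
  then show ?thesis by simp
qed

lemma has_derivative_spherical:
  "((\<lambda>x. (x$1) *\<^sub>R polar_direction (x$2) (x$3)) has_derivative (\<lambda>h. spherical_jacobian x *v h)) (at x within S)"
proof (subst has_derivative_componentwise_within, rule ballI)
  fix b :: "real^3" assume "b \<in> Basis"
  then obtain i :: 3 where b: "b = axis i 1" by (auto simp: Basis_vec_def)
  have nth: "((\<lambda>x::real^3. x $ j) has_derivative (\<lambda>h. h $ j)) (at x within S)" for j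
    by (rule bounded_linear.has_derivative[OF bounded_linear_vec_nth has_derivative_ident])
  show "((\<lambda>x. (x$1) *\<^sub>R polar_direction (x$2) (x$3) \<bullet> b) has_derivative (\<lambda>h. (spherical_jacobian x *v h) \<bullet> b)) (at x within S)"
  proof -
    consider "i = 1" | "i = 2" | "i = 3" using exhaust_3[of i] by blast
    then show ?thesis
    proof cases
      case 1
      show ?thesis unfolding b 1
        by (auto simp: inner_axis matrix_vector_mult_def sum_3 spherical_jacobian_def vector_3 algebra_simps
                 intro!: derivative_eq_intros nth)
    next
      case 2
      show ?thesis unfolding b 2
        by (auto simp: inner_axis matrix_vector_mult_def sum_3 spherical_jacobian_def vector_3 algebra_simps
                 intro!: derivative_eq_intros nth)
    next
      case 3
      show ?thesis unfolding b 3
        by (auto simp: inner_axis matrix_vector_mult_def sum_3 spherical_jacobian_def vector_3 algebra_simps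
                 intro!: derivative_eq_intros nth)
    qed
  qed
qed

text \<open>The spherical coordinate chart misses only part of a plane, which is a null set.\<close>

lemma emeasure_cone_ball:
  fixes Q :: "real^3 \<Rightarrow> real^3"
  assumes Q: "orthogonal_transformation Q" and A: "A \<in> sets borel"
  shows "emeasure lborel {x \<in> ball 0 1. R *\<^sub>R sgn x \<in> A} =
    (\<integral>\<^sup>+x. ennreal (indicator {0<..<1} (x$1) * indicator {0<..<2*pi} (x$2) * indicator {0<..<pi} (x$3) *
      ((x$1)\<^sup>2 * sin (x$3)) * indicator A (R *\<^sub>R Q (polar_direction (x$2) (x$3)))) \<partial>(lborel :: (real^3) measure))"
proof -
  define D where "D = {x \<in> ball 0 1. R *\<^sub>R sgn x \<in> A}"
  define S :: "(real^3) set" where "S = {x. 0 < x$1 \<and> x$1 < 1 \<and> 0 < x$2 \<and> x$2 < 2*pi \<and> 0 < x$3 \<and> x$3 < pi}"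
  \<comment> \<open>The axis is turned inside the chart instead of proving separately that the
    uniform law is rotation invariant; an orthogonal \<open>Q\<close> preserves norms and the
    absolute value of the determinant.\<close>
  define g where "g = (\<lambda>x::real^3. Q ((x$1) *\<^sub>R polar_direction (x$2) (x$3)))"
  define w where "w = (\<lambda>x::real^3. indicator {0<..<1} (x$1) * indicator {0<..<2*pi} (x$2) * indicator {0<..<pi} (x$3) *
      ((x$1)\<^sup>2 * sin (x$3)) * indicator A (R *\<^sub>R Q (polar_direction (x$2) (x$3))) :: real)"
  have lin: "linear Q" using Q by (rule orthogonal_transformation_linear)
  have nQ: "norm (Q x) = norm x" for x using Q by (simp add: orthogonal_transformation)
  have injQ: "inj Q" using Q by (rule orthogonal_transformation_inj)
  have contQ: "continuous_on T Q" for T using lin by (simp add: linear_continuous_on linear_conv_bounded_linear)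
  have sgn_meas: "sgn \<in> borel_measurable (borel :: (real^3) measure)"
    unfolding sgn_div_norm by measurable
  have D: "D \<in> sets borel"
  proof -
    have "{x. R *\<^sub>R sgn x \<in> A} = (\<lambda>x. R *\<^sub>R sgn x) -` A \<inter> space borel" by auto
    also have "\<dots> \<in> sets borel"
      using sgn_meas A by (intro measurable_sets[OF borel_measurable_scaleR]) auto
    finally have "ball 0 1 \<inter> {x. R *\<^sub>R sgn x \<in> A} \<in> sets borel" by auto
    moreover have "D = ball 0 1 \<inter> {x. R *\<^sub>R sgn x \<in> A}" by (auto simp: D_def)
    ultimately show ?thesis by simp
  qed
  have openS: "open S"
    unfolding S_def by (intro open_Collect_conj open_Collect_less continuous_intros)
  have g_eq: "g x = (x$1) *\<^sub>R Q (polar_direction (x$2) (x$3))" for x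
    unfolding g_def using lin by (simp add: linear_cmul)
  have ng: "x \<in> S \<Longrightarrow> norm (g x) = x$1" for x
    by (simp add: g_eq nQ S_def)
  have contg: "continuous_on S g"
    unfolding g_eq by (intro continuous_intros continuous_on_compose2[OF contQ[of UNIV]]) auto
  have injg: "inj_on g S"
  proof (rule inj_onI)
    fix x y assume x: "x \<in> S" and y: "y \<in> S" and eq: "g x = g y"
    have 1: "x$1 = y$1" using ng x y eq by metis
    have "Q (polar_direction (x$2) (x$3)) = Q (polar_direction (y$2) (y$3))"
      using eq 1 x by (simp add: g_eq S_def)
    then have "polar_direction (x$2) (x$3) = polar_direction (y$2) (y$3)" using injQ by (simp add: inj_eq)
    then have "x$2 = y$2" "x$3 = y$3" using polar_direction_inj[of "x$2" "x$3" "y$2" "y$3"] x y by (auto simp: S_def)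
    with 1 show "x = y" by (simp add: vec_eq_iff forall_3)
  qed
  \<comment> \<open>A continuous injective image of an open set of the same dimension is open; this
    is where the measurability of the image comes from.\<close>
  have open_gS: "open (g ` S)" using contg openS injg by (rule invariance_of_domain)
  \<comment> \<open>The image under \<open>Q\<close> of the plane \<open>y $ 2 = 0\<close>. A point
    outside it, pulled back by \<open>Q\<close>, satisfies the hypothesis of
    \<open>ex_polar_direction\<close> after normalisation.\<close>
  define P where "P = {x. Q (axis 2 1) \<bullet> x = 0}"
  have "Q (axis 2 1) \<noteq> 0" using nQ[of "axis 2 1"] by (metis norm_axis_1 norm_zero zero_neq_one)
  then have negP: "negligible P" unfolding P_def by (rule negligible_hyperplane[OF disjI1])
  have sub: "ball 0 1 - P \<subseteq> g ` S"
  proof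
    fix x assume x: "x \<in> ball 0 1 - P"
    obtain y where y: "x = Q y" using orthogonal_transformation_surj[OF Q] by (metis surjD)
    have "Q (axis 2 1) \<bullet> Q y \<noteq> 0" using x y by (simp add: P_def)
    then have y2: "y $ 2 \<noteq> 0" using Q by (simp add: orthogonal_transformation_def inner_axis' )
    then have y0: "norm y > 0" by auto
    have y1: "norm y < 1" using x y nQ by simp
    have "norm (y /\<^sub>R norm y) = 1" "(y /\<^sub>R norm y) $ 2 \<noteq> 0" using y0 y2 by auto
    then obtain \<phi> \<psi> where p: "0 < \<phi>" "\<phi> < 2 * pi" "0 < \<psi>" "\<psi> < pi" "y /\<^sub>R norm y = polar_direction \<phi> \<psi>"
      by (rule ex_polar_direction)
    define z :: "real^3" where "z = vector [norm y, \<phi>, \<psi>]"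
    have z: "z$1 = norm y" "z$2 = \<phi>" "z$3 = \<psi>" by (simp_all add: z_def)
    have "z \<in> S" using p y0 y1 by (simp add: S_def z)
    moreover have "g z = x" using p(5) y0 by (simp add: g_def z p(5)[symmetric] y)
    ultimately show "x \<in> g ` S" by blast
  qed
  have deriv: "(g has_derivative (\<lambda>h. Q (spherical_jacobian x *v h))) (at x within T)" for x T
    unfolding g_def
    using bounded_linear.has_derivative[OF _ has_derivative_spherical] lin by (simp add: linear_conv_bounded_linear)
  have det: "\<bar>det (matrix (\<lambda>h. Q (spherical_jacobian x *v h)))\<bar> = (x$1)\<^sup>2 * sin (x$3)" if "x \<in> S" for x
  proof -
    have "matrix (\<lambda>h. Q (spherical_jacobian x *v h)) = matrix Q ** spherical_jacobian x"
      using matrix_compose[of "\<lambda>h. spherical_jacobian x *v h" Q] lin by (simp add: o_def matrix_vector_mul_linear)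
    then have "det (matrix (\<lambda>h. Q (spherical_jacobian x *v h))) = det (matrix Q) * det (spherical_jacobian x)"
      by (simp add: det_mul)
    moreover have "\<bar>det (matrix Q)\<bar> = 1"
      using Q det_orthogonal_matrix[of "matrix Q"] by (auto simp: orthogonal_transformation_matrix)
    moreover have "sin (x$3) \<ge> 0" using that by (intro sin_ge_zero) (auto simp: S_def)
    ultimately show ?thesis by (simp add: abs_mult det_spherical_jacobian)
  qed
  have Dfin: "D \<in> lmeasurable"
    using D by (intro bounded_set_imp_lmeasurable bounded_subset[OF bounded_ball[of 0 1]]) (auto simp: D_def)
  have Dg: "D \<inter> g ` S \<in> lmeasurable"
    using Dfin open_gS by (intro fmeasurable_Int_fmeasurable) auto
  have meas_dir: "(\<lambda>x::real^3. R *\<^sub>R Q (polar_direction (x$2) (x$3))) \<in> borel_measurable borel"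
    by (intro borel_measurable_continuous_onI continuous_intros continuous_on_compose2[OF contQ[of UNIV]]) auto
  have meas_w: "w \<in> borel_measurable lborel"
  proof -
    note meas_dir[measurable]
    have [measurable]: "(\<lambda>x::real^3. x $ i) \<in> borel_measurable borel" for i
      by (intro borel_measurable_continuous_onI continuous_intros)
    note A[measurable]
    show ?thesis unfolding w_def by measurable
  qed
  have w_nonneg: "0 \<le> w x" for x
    by (auto simp: w_def indicator_def intro!: mult_nonneg_nonneg sin_ge_zero)
  \<comment> \<open>\<open>g\<close> maps this set onto the charted part of \<open>D\<close>, whose
    volume is therefore the integral of the absolute determinant over it. For \<open>x\<close> in
    \<open>S\<close>, whether \<open>g x\<close> lies in \<open>D\<close> does not depend on the
    radius \<open>x $ 1\<close>.\<close>
  define S' where "S' = {x \<in> S. R *\<^sub>R Q (polar_direction (x$2) (x$3)) \<in> A}"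
  have gS': "g ` S' = D \<inter> g ` S"
  proof -
    have "g x \<in> D \<longleftrightarrow> R *\<^sub>R Q (polar_direction (x$2) (x$3)) \<in> A" if "x \<in> S" for x
    proof -
      have "sgn (g x) = Q (polar_direction (x$2) (x$3))"
        using that by (simp add: g_eq sgn_div_norm nQ S_def)
      then show ?thesis using ng[OF that] that by (simp add: D_def S_def)
    qed
    then show ?thesis by (auto simp: S'_def)
  qed
  have "S' \<in> sets borel"
  proof -
    have "S' = S \<inter> ((\<lambda>x. R *\<^sub>R Q (polar_direction (x$2) (x$3))) -` A \<inter> space borel)"
      by (auto simp: S'_def)
    then show ?thesis using measurable_sets[OF meas_dir A] openS by auto
  qed
  moreover have "inj_on g S'" using injg by (rule inj_on_subset) (auto simp: S'_def)
  ultimately have "((\<lambda>x. \<bar>det (matrix (\<lambda>h. Q (spherical_jacobian x *v h)))\<bar>) has_integral measure lebesgue (D \<inter> g ` S)) S'"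
    using has_measure_differentiable_image[of S' g "\<lambda>x h. Q (spherical_jacobian x *v h)" "measure lebesgue (D \<inter> g ` S)"]
      deriv Dg gS' by auto
  then have "((\<lambda>x. if x \<in> S' then \<bar>det (matrix (\<lambda>h. Q (spherical_jacobian x *v h)))\<bar> else 0) has_integral measure lebesgue (D \<inter> g ` S)) UNIV"
    by (simp add: has_integral_restrict_UNIV)
  also have "(\<lambda>x. if x \<in> S' then \<bar>det (matrix (\<lambda>h. Q (spherical_jacobian x *v h)))\<bar> else 0) = w"
    by (auto simp: fun_eq_iff w_def S'_def det indicator_def) (auto simp: S_def)
  finally have "(\<integral>\<^sup>+x. ennreal (w x) \<partial>lborel) = ennreal (measure lebesgue (D \<inter> g ` S))"
    using meas_w w_nonneg by (intro nn_integral_has_integral_lborel) auto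
  also have "\<dots> = emeasure lebesgue (D \<inter> g ` S)"
    by (rule emeasure_eq_ennreal_measure[symmetric]) (rule fmeasurableD2[OF Dg])
  \<comment> \<open>The points of \<open>D\<close> missed by the chart all lie in the plane
    \<open>P\<close>.\<close>
  also have "\<dots> = emeasure lebesgue D"
  proof (rule emeasure_eq_AE)
    have "AE x in lebesgue. x \<notin> P" using negP by (simp add: AE_not_in negligible_iff_null_sets)
    then show "AE x in lebesgue. (x \<in> D \<inter> g ` S) = (x \<in> D)"
    proof eventually_elim
      case (elim x)
      then show ?case using sub unfolding D_def by blast
    qed
  qed (use Dg Dfin in auto)
  also have "\<dots> = emeasure lborel D" using D by simp
  finally show ?thesis unfolding D_def w_def by simp
qed

text \<open>The cone volume splits into a radial and an angular integral. The radial one is 1/3 and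
  the ball has volume 4 pi / 3, so the density sin \<psi> / (4 pi) remains. That the same density
  serves every \<open>Q\<close> is the rotation invariance of the uniform law.\<close>

lemma uniform_sphere_eq_distr:
  assumes Q: "orthogonal_transformation Q"
  shows "uniform_sphere R = distr
    (density lborel (\<lambda>(\<phi>, \<psi>). ennreal (indicator {0<..<2*pi} \<phi> * indicator {0<..<pi} \<psi> * (sin \<psi> / (4 * pi)))))
    borel (\<lambda>(\<phi>, \<psi>). R *\<^sub>R Q (polar_direction \<phi> \<psi>))" (is "_ = distr (density lborel ?d) borel ?T")
proof (rule measure_eqI)
  show "sets (uniform_sphere R) = sets (distr (density lborel ?d) borel ?T)"
    by (simp add: uniform_sphere_def)
  fix A assume "A \<in> sets (uniform_sphere R)"
  then have A[measurable]: "A \<in> sets borel" by (simp add: uniform_sphere_def)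
  have lin: "linear Q" using Q by (rule orthogonal_transformation_linear)
  have contQ: "continuous_on UNIV Q" using lin by (simp add: linear_continuous_on linear_conv_bounded_linear)
  have T[measurable]: "?T \<in> borel_measurable borel"
    unfolding case_prod_beta
    by (intro borel_measurable_continuous_onI continuous_intros continuous_on_compose2[OF contQ]) auto
  have d[measurable]: "?d \<in> borel_measurable borel"
    unfolding borel_prod[symmetric] by measurable
  have [measurable]: "sgn \<in> borel_measurable (borel :: (real^3) measure)"
    unfolding sgn_div_norm by measurable
  define k where "k = (\<lambda>r::real. indicator {0<..<1} r * r\<^sup>2)"
  define G where "G = (\<lambda>p. ?d p * indicator A (?T p))"
  have G[measurable]: "G \<in> borel_measurable borel" unfolding G_def by measurable
  have k[measurable]: "k \<in> borel_measurable borel" unfolding k_def by measurable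
  have k_nonneg: "0 \<le> k r" for r by (simp add: k_def)
  have int_k: "(\<integral>\<^sup>+r. ennreal (k r) \<partial>lborel) = ennreal (1/3)"
  proof -
    have "(\<integral>\<^sup>+r. ennreal (k r) \<partial>lborel) = (\<integral>\<^sup>+r. ennreal (r\<^sup>2) * indicator {0..1} r \<partial>lborel)"
      by (intro nn_integral_cong_AE, rule AE_mp[OF AE_conjI[OF AE_lborel_singleton[of 0] AE_lborel_singleton[of 1]]])
         (auto simp: k_def indicator_def)
    also have "\<dots> = ennreal (1^3/3 - 0^3/3)"
      by (rule nn_integral_FTC_Icc) (auto intro!: derivative_eq_intros simp: has_real_derivative_iff_has_vector_derivative[symmetric])
    finally show ?thesis by simp
  qed
  have T3[measurable]: "(\<lambda>(r, \<phi>, \<psi>). vector [r, \<phi>, \<psi>] :: real^3) \<in> borel_measurable lborel"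
    using measurable_vector3 by simp
  have eq: "ennreal (indicator {0<..<1} r * indicator {0<..<2*pi} \<phi> * indicator {0<..<pi} \<psi> *
      (r\<^sup>2 * sin \<psi>) * indicator A (R *\<^sub>R Q (polar_direction \<phi> \<psi>))) =
      ennreal (k r) * (ennreal (4 * pi) * G (\<phi>, \<psi>))" for r \<phi> \<psi>
  proof -
    have s: "0 \<le> sin \<psi>" if "0 < \<psi>" "\<psi> < pi" using that by (intro sin_ge_zero) auto
    show ?thesis
      unfolding G_def k_def using s by (auto simp: indicator_def ennreal_mult'[symmetric] ennreal_mult[symmetric])
  qed
  have [measurable]: "(\<lambda>x::real^3. x $ i) \<in> borel_measurable borel" for i
    by (intro borel_measurable_continuous_onI continuous_intros)
  have dir[measurable]: "(\<lambda>x::real^3. R *\<^sub>R Q (polar_direction (x$2) (x$3))) \<in> borel_measurable borel"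
    by (intro borel_measurable_continuous_onI continuous_intros continuous_on_compose2[OF contQ]) auto
  have "emeasure lborel {x \<in> ball 0 1. R *\<^sub>R sgn x \<in> A} =
    (\<integral>\<^sup>+p. ennreal (k (fst p)) * (ennreal (4 * pi) * G (snd p)) \<partial>lborel)"
    unfolding emeasure_cone_ball[OF Q A]
    by (subst lborel_vec3_eq_distr, subst nn_integral_distr[OF T3])
       (simp_all add: eq case_prod_beta)
  also have "\<dots> = (\<integral>\<^sup>+r. \<integral>\<^sup>+p. ennreal (k r) * (ennreal (4 * pi) * G p) \<partial>lborel \<partial>lborel)"
    unfolding lborel_prod[symmetric, where ?'a = real and ?'b = "real \<times> real"]
    by (subst lborel.nn_integral_fst[symmetric]) auto
  also have "\<dots> = ennreal (1/3) * (ennreal (4 * pi) * (\<integral>\<^sup>+p. G p \<partial>lborel))"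
    by (simp add: nn_integral_cmult nn_integral_multc int_k)
  finally have cone: "emeasure lborel {x \<in> ball 0 1. R *\<^sub>R sgn x \<in> A} =
      ennreal (4/3 * pi) * (\<integral>\<^sup>+p. G p \<partial>lborel)"
    by (simp add: ennreal_mult[symmetric] mult.assoc[symmetric])
  have ball: "emeasure lborel (ball (0::real^3) 1) = ennreal (4/3 * pi)"
    by (simp add: emeasure_ball unit_ball_vol_3)
  have "emeasure (uniform_sphere R) A = emeasure lborel (ball 0 1 \<inter> ((\<lambda>x::real^3. R *\<^sub>R sgn x) -` A)) / emeasure lborel (ball (0::real^3) 1)"
  proof -
    have "(\<lambda>x::real^3. R *\<^sub>R sgn x) -` A \<inter> space borel \<in> sets borel"
      by (rule measurable_sets[OF _ A]) measurable
    then show ?thesis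
      unfolding uniform_sphere_def by (subst emeasure_distr) auto
  qed
  also have "ball 0 1 \<inter> ((\<lambda>x::real^3. R *\<^sub>R sgn x) -` A) = {x \<in> ball 0 1. R *\<^sub>R sgn x \<in> A}" by auto
  also have "emeasure lborel \<dots> / emeasure lborel (ball (0::real^3) 1) = (\<integral>\<^sup>+p. G p \<partial>lborel)"
    unfolding cone ball by (simp add: ennreal_mult_divide_eq mult.commute)
  also have "\<dots> = emeasure (distr (density lborel ?d) borel ?T) A"
  proof -
    have "?T -` A \<inter> space borel \<in> sets borel" by (rule measurable_sets[OF T A])
    then have "emeasure (density lborel ?d) (?T -` A) = (\<integral>\<^sup>+p. ?d p * indicator (?T -` A) p \<partial>lborel)"
      using d by (intro emeasure_density) auto
    moreover have "emeasure (distr (density lborel ?d) borel ?T) A = emeasure (density lborel ?d) (?T -` A)"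
      using T A by (subst emeasure_distr) auto
    ultimately show ?thesis by (simp add: G_def indicator_def)
  qed
  finally show "emeasure (uniform_sphere R) A = emeasure (distr (density lborel ?d) borel ?T) A" .
qed

subsection \<open>Uniform points on spheres and caps\<close>

text \<open>Gram-Schmidt, completed by a cross product: the direction of \<open>c\<close> is the
  pole and \<open>u\<close> lies in the half-plane of azimuth 0. This choice is why only the cosine
  of the azimuth occurs in \<open>r_FU\<close>.\<close>

lemma ex_orthogonal_frame:
  fixes c u :: "real^3"
  assumes c: "c \<noteq> 0" and u: "u \<noteq> 0"
  obtains Q :: "real^3 \<Rightarrow> real^3" where "orthogonal_transformation Q" "Q (axis 3 1) = c /\<^sub>R norm c"
    "u /\<^sub>R norm u = sin (central_angle c u) *\<^sub>R Q (axis 1 1) + cos (central_angle c u) *\<^sub>R Q (axis 3 1)"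
proof -
  define e3 where "e3 = c /\<^sub>R norm c"
  define t where "t = (c \<bullet> u) / (norm c * norm u)"
  have ne3: "norm e3 = 1" using c by (simp add: e3_def)
  have t: "t = (u /\<^sub>R norm u) \<bullet> e3" by (simp add: t_def e3_def inner_commute field_simps)
  define v where "v = u /\<^sub>R norm u - t *\<^sub>R e3"
  have "norm (u /\<^sub>R norm u) = 1" using u by simp
  then have uu: "(u /\<^sub>R norm u) \<bullet> (u /\<^sub>R norm u) = 1" by (simp only: norm_eq_1)
  have e33: "e3 \<bullet> e3 = 1" using ne3 by (simp only: norm_eq_1)
  have ve3: "v \<bullet> e3 = 0" unfolding v_def by (simp add: inner_diff_left e33 t)
  have vv: "v \<bullet> v = 1 - t\<^sup>2"
  proof -
    define n where "n = u /\<^sub>R norm u"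
    have "n \<bullet> n = 1" "n \<bullet> e3 = t" using uu t by (simp_all only: n_def)
    moreover have "v = n - t *\<^sub>R e3" by (simp only: v_def n_def)
    ultimately show ?thesis
      using e33 by (simp add: inner_diff_left inner_diff_right inner_commute[of e3 n] power2_eq_square)
  qed
  have tb: "\<bar>t\<bar> \<le> 1" using vv inner_ge_zero[of v] by (simp add: abs_square_le_1)
  have cos: "cos (central_angle c u) = t" unfolding central_angle_def t_def[symmetric] using tb by (simp add: cos_arccos_abs)
  have sin: "sin (central_angle c u) = norm v"
    unfolding central_angle_def t_def[symmetric] using tb by (simp add: sin_arccos_abs norm_eq_sqrt_inner vv)
  \<comment> \<open>If \<open>u\<close> is parallel to \<open>c\<close>, then \<open>v\<close>
    vanishes and any unit vector orthogonal to \<open>e3\<close> will do.\<close>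
  obtain e1 where ne1: "norm e1 = 1" and e13: "e1 \<bullet> e3 = 0" and ve1: "v = norm v *\<^sub>R e1"
  proof (cases "v = 0")
    case True
    obtain y where "y \<noteq> 0" "orthogonal e3 y"
      using ne3 orthogonal_to_vector_exists[of e3] by auto
    then show ?thesis using that[of "y /\<^sub>R norm y"] True by (simp add: orthogonal_def inner_commute)
  next
    case False
    then show ?thesis using that[of "v /\<^sub>R norm v"] ve3 by simp
  qed
  define e2 where "e2 = cross3 e3 e1"
  have e11: "e1 \<bullet> e1 = 1" using ne1 by (simp only: norm_eq_1)
  have e12: "e1 \<bullet> e2 = 0" "e3 \<bullet> e2 = 0" by (simp_all add: e2_def dot_cross_self)
  have e22: "e2 \<bullet> e2 = 1"
    unfolding e2_def by (simp add: dot_cross e11 e33 e13 inner_commute[of e3 e1])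
  define Q where "Q = (\<lambda>x::real^3. x$1 *\<^sub>R e1 + x$2 *\<^sub>R e2 + x$3 *\<^sub>R e3)"
  have "linear Q" unfolding Q_def
    by (rule linearI) (auto simp: algebra_simps)
  moreover have "Q x \<bullet> Q y = x \<bullet> y" for x y :: "real^3"
  proof -
    have "Q x \<bullet> Q y = x$1 * y$1 + x$2 * y$2 + x$3 * y$3"
      unfolding Q_def
      by (simp add: inner_add_left inner_add_right e11 e22 e33 e12 e13 inner_commute[of e3 e1] inner_commute[of e2 e1] inner_commute[of e2 e3])
    then show ?thesis by (simp add: inner_vec_def sum_3)
  qed
  ultimately have "orthogonal_transformation Q" by (simp add: orthogonal_transformation_def)
  moreover have Q1: "Q (axis 1 1) = e1" and Q3: "Q (axis 3 1) = e3" by (simp_all add: Q_def axis_def)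
  moreover have "u /\<^sub>R norm u = v + t *\<^sub>R e3" by (simp add: v_def)
  ultimately show ?thesis using that[of Q] sin cos ve1 e3_def by metis
qed

lemma sets_uniform_sphere [simp, measurable_cong]: "sets (uniform_sphere R) = sets borel"
  and space_uniform_sphere [simp]: "space (uniform_sphere R) = UNIV"
  by (simp_all add: uniform_sphere_def)

lemma measurable_scaleR_sgn: "(\<lambda>x::real^3. R *\<^sub>R sgn x) \<in> borel_measurable borel"
  unfolding sgn_div_norm by measurable

lemma prob_space_uniform_sphere: "prob_space (uniform_sphere R)"
proof -
  have "prob_space (uniform_measure lborel (ball (0::real^3) 1))"
    by (rule prob_space_uniform_measure) (auto simp: emeasure_ball unit_ball_vol_3)
  then show ?thesis
    unfolding uniform_sphere_def by (rule prob_space.prob_space_distr) (simp add: measurable_scaleR_sgn)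
qed

lemma AE_uniform_sphere_norm:
  assumes "R \<ge> 0"
  shows "AE x in uniform_sphere R. norm x = R"
proof -
  \<comment> \<open>Since \<open>sgn 0 = 0\<close>, the centre of the ball is the only point whose
    projection can miss the sphere.\<close>
  have "AE x in lborel. x \<noteq> (0::real^3)" by (rule AE_lborel_singleton)
  then have "AE x in uniform_measure lborel (ball (0::real^3) 1). x \<noteq> 0"
    by (intro AE_uniform_measureI) auto
  then have "AE x in uniform_measure lborel (ball (0::real^3) 1). norm (R *\<^sub>R sgn x) = R"
    by eventually_elim (use assms in \<open>simp add: norm_sgn\<close>)
  then show ?thesis
    unfolding uniform_sphere_def by (subst AE_distr_iff) (auto simp: measurable_scaleR_sgn)
qed

lemma central_angle_frame:
  assumes Q: "orthogonal_transformation Q" and Qc: "Q (axis 3 1) = c /\<^sub>R norm c" and c: "c \<noteq> 0" and R: "R > 0"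
    and \<psi>: "0 \<le> \<psi>" "\<psi> \<le> pi"
  shows "central_angle c (R *\<^sub>R Q (polar_direction \<phi> \<psi>)) = \<psi>"
proof -
  have nQ: "norm (Q x) = norm x" for x using Q by (simp add: orthogonal_transformation)
  have "c = norm c *\<^sub>R Q (axis 3 1)" using Qc c by simp
  then have "c \<bullet> Q (polar_direction \<phi> \<psi>) = norm c * (Q (axis 3 1) \<bullet> Q (polar_direction \<phi> \<psi>))"
    by (metis inner_scaleR_left)
  also have "\<dots> = norm c * cos \<psi>"
    using Q by (simp add: orthogonal_transformation_def inner_axis')
  finally show ?thesis using R c \<psi> by (simp add: central_angle_def nQ arccos_cos)
qed

text \<open>Zero vectors are included, the quotient being 0 there by the convention on division; the
  facts on \<open>central_angle\<close> below thus hold for all vectors.\<close>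

lemma central_angle_quotient_bounds: "\<bar>(x \<bullet> y) / (norm x * norm y)\<bar> \<le> 1"
  for x y :: "real^3"
proof (cases "x = 0 \<or> y = 0")
  case False
  then have "0 < norm x * norm y" by simp
  then show ?thesis using Cauchy_Schwarz_ineq2[of x y] by (simp only: abs_divide abs_mult abs_norm_cancel divide_le_eq_1_pos)
qed auto

lemma borel_measurable_central_angle [measurable]:
  assumes [measurable]: "f \<in> borel_measurable M" "g \<in> borel_measurable M"
  shows "(\<lambda>x. central_angle (f x) (g x)) \<in> borel_measurable M"
proof -
  \<comment> \<open>\<open>arccos\<close> is continuous on [-1, 1] only. Clamping the argument makes
    a continuous function on the whole line, and by Cauchy-Schwarz the clamp changes
    nothing.\<close>
  have "continuous_on UNIV (\<lambda>t::real. arccos (max (-1) (min 1 t)))"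
    by (intro continuous_on_arccos continuous_intros) auto
  then have [measurable]: "(\<lambda>t::real. arccos (max (-1) (min 1 t))) \<in> borel_measurable borel"
    by (rule borel_measurable_continuous_onI)
  have "central_angle x y = arccos (max (-1) (min 1 ((x \<bullet> y) / (norm x * norm y))))" for x y
    using central_angle_quotient_bounds[of x y] unfolding central_angle_def abs_le_iff by (simp only: min_def max_def) (smt (verit))
  then show ?thesis by simp
qed

lemma central_angle_bounds: "0 \<le> central_angle x y" "central_angle x y \<le> pi"
  using central_angle_quotient_bounds[of x y] arccos_bounded[of "(x \<bullet> y) / (norm x * norm y)"]
  unfolding central_angle_def abs_le_iff by linarith+

lemma cos_central_angle: "cos (central_angle x y) = (x \<bullet> y) / (norm x * norm y)"
  using central_angle_quotient_bounds[of x y] by (simp add: central_angle_def cos_arccos_abs)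

lemma sets_spherical_cap [measurable]: "spherical_cap R c \<alpha> \<in> sets borel"
proof -
  have "spherical_cap R c \<alpha> = {x \<in> space borel. norm x = R \<and> central_angle c x \<le> \<alpha>}"
    by (auto simp: spherical_cap_def)
  also have "\<dots> \<in> sets borel" by measurable
  finally show ?thesis .
qed

text \<open>In coordinates with pole \<open>c\<close> the polar angle is the central angle to
  \<open>c\<close>, so the cap becomes a rectangle of angles.\<close>

lemma nn_integral_spherical_cap:
  assumes Q: "orthogonal_transformation Q" and Qc: "Q (axis 3 1) = c /\<^sub>R norm c" and c: "c \<noteq> 0" and R: "R > 0"
    and \<alpha>: "0 \<le> \<alpha>" "\<alpha> \<le> pi"
    and h[measurable]: "h \<in> borel_measurable borel"
  shows "(\<integral>\<^sup>+x. h x * indicator (spherical_cap R c \<alpha>) x \<partial>uniform_sphere R) =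
    (\<integral>\<^sup>+\<phi>. \<integral>\<^sup>+\<psi>. ennreal (indicator {0<..<2*pi} \<phi> * indicator {0<..<\<alpha>} \<psi> * (sin \<psi> / (4 * pi))) *
       h (R *\<^sub>R Q (polar_direction \<phi> \<psi>)) \<partial>lborel \<partial>lborel)"
proof -
  let ?T = "\<lambda>(\<phi>, \<psi>). R *\<^sub>R Q (polar_direction \<phi> \<psi>)"
  let ?d = "\<lambda>(\<phi>, \<psi>). ennreal (indicator {0<..<2*pi} \<phi> * indicator {0<..<pi} \<psi> * (sin \<psi> / (4 * pi)))"
  have lin: "linear Q" using Q by (rule orthogonal_transformation_linear)
  have nQ: "norm (Q x) = norm x" for x using Q by (simp add: orthogonal_transformation)
  have contQ: "continuous_on UNIV Q" using lin by (simp add: linear_continuous_on linear_conv_bounded_linear)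
  have T[measurable]: "?T \<in> borel_measurable (borel \<Otimes>\<^sub>M borel)"
    unfolding case_prod_beta borel_prod
    by (intro borel_measurable_continuous_onI continuous_intros continuous_on_compose2[OF contQ]) auto
  have d[measurable]: "?d \<in> borel_measurable (borel \<Otimes>\<^sub>M borel)" by measurable
  let ?H = "\<lambda>x. h x * indicator (spherical_cap R c \<alpha>) x"
  have "(\<integral>\<^sup>+x. ?H x \<partial>uniform_sphere R) = (\<integral>\<^sup>+p. ?d p * ?H (?T p) \<partial>lborel)"
  proof -
    have [measurable]: "(\<lambda>p. ?d p * ?H (?T p)) \<in> borel_measurable (borel \<Otimes>\<^sub>M borel)" by measurable
    have m1: "?T \<in> borel_measurable borel" "?d \<in> borel_measurable borel" "(\<lambda>p. ?H (?T p)) \<in> borel_measurable borel"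
      unfolding borel_prod[symmetric] by measurable
    show ?thesis
      unfolding uniform_sphere_eq_distr[OF Q, of R] using m1
      by (subst nn_integral_distr) (simp_all add: nn_integral_density)
  qed
  also have "\<dots> = (\<integral>\<^sup>+\<phi>. \<integral>\<^sup>+\<psi>. ?d (\<phi>, \<psi>) * ?H (?T (\<phi>, \<psi>)) \<partial>lborel \<partial>lborel)"
  proof -
    have "(\<lambda>p. ?d p * ?H (?T p)) \<in> borel_measurable (lborel \<Otimes>\<^sub>M lborel)"
      by measurable
    from lborel.nn_integral_fst[OF this] show ?thesis unfolding lborel_prod by simp
  qed
  also have "\<dots> = (\<integral>\<^sup>+\<phi>. \<integral>\<^sup>+\<psi>. ennreal (indicator {0<..<2*pi} \<phi> * indicator {0<..<\<alpha>} \<psi> * (sin \<psi> / (4 * pi))) *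
       h (R *\<^sub>R Q (polar_direction \<phi> \<psi>)) \<partial>lborel \<partial>lborel)"
  proof (rule nn_integral_cong, rule nn_integral_cong_AE)
    fix \<phi> :: real
    have cap: "R *\<^sub>R Q (polar_direction \<phi> \<psi>) \<in> spherical_cap R c \<alpha> \<longleftrightarrow> \<psi> \<le> \<alpha>" if "0 < \<psi>" "\<psi> < pi" for \<psi>
      using central_angle_frame[OF Q Qc c R, of \<psi> \<phi>] that R by (simp add: spherical_cap_def nQ)
    \<comment> \<open>The boundary circle of the cap is a null set, which reconciles the closed cap
      with the open interval.\<close>
    have "AE \<psi> in lborel. \<psi> \<noteq> \<alpha>" by (rule AE_lborel_singleton)
    then show "AE \<psi> in lborel. ?d (\<phi>, \<psi>) * ?H (?T (\<phi>, \<psi>)) =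
        ennreal (indicator {0<..<2*pi} \<phi> * indicator {0<..<\<alpha>} \<psi> * (sin \<psi> / (4 * pi))) * h (R *\<^sub>R Q (polar_direction \<phi> \<psi>))"
    proof eventually_elim
      case (elim \<psi>)
      then show ?case using \<alpha> cap[of \<psi>] by (auto simp: indicator_def)
    qed
  qed
  finally show ?thesis .
qed

text \<open>The passage from nonnegative integrals to the iterated interval integrals of the claim.
  The bound \<open>B\<close> makes the integrand integrable over a rectangle of finite area, so both
  iterated integrals equal one double integral. \<open>K\<close> is free in order to cover the
  density of the sphere as well as that of the cap.\<close>

lemma nn_integral_polar_rectangle:
  fixes h :: "real \<Rightarrow> real \<Rightarrow> real"
  assumes \<alpha>: "0 \<le> \<alpha>" "\<alpha> \<le> pi" and K: "K \<ge> 0"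
    and h[measurable]: "(\<lambda>(\<phi>, \<psi>). h \<phi> \<psi>) \<in> borel_measurable (borel \<Otimes>\<^sub>M borel)"
    and b: "\<And>\<phi> \<psi>. 0 \<le> h \<phi> \<psi>" "\<And>\<phi> \<psi>. h \<phi> \<psi> \<le> B"
  shows "(\<integral>\<^sup>+\<phi>. \<integral>\<^sup>+\<psi>. ennreal (indicator {0<..<2*pi} \<phi> * indicator {0<..<\<alpha>} \<psi> * (sin \<psi> * K)) * ennreal (h \<phi> \<psi>) \<partial>lborel \<partial>lborel)
     = ennreal (LBINT \<phi>=0..ereal (2 * pi). (LBINT \<psi>=0..ereal \<alpha>. sin \<psi> * K * h \<phi> \<psi>))"
    and "0 \<le> (LBINT \<phi>=0..ereal (2 * pi). (LBINT \<psi>=0..ereal \<alpha>. sin \<psi> * K * h \<phi> \<psi>))"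
proof -
  define w where "w = (\<lambda>\<phi> \<psi>. indicator {0<..<2*pi} \<phi> * (indicator {0<..<\<alpha>} \<psi> * (sin \<psi> * K * h \<phi> \<psi>)) :: real)"
  have s: "0 \<le> sin \<psi>" if "0 < \<psi>" "\<psi> < \<alpha>" for \<psi> using that \<alpha> by (intro sin_ge_zero) auto
  have w0: "0 \<le> w \<phi> \<psi>" for \<phi> \<psi>
    using s K b by (auto simp: w_def indicator_def)
  have [measurable]: "(\<lambda>(\<phi>, \<psi>). w \<phi> \<psi>) \<in> borel_measurable (borel \<Otimes>\<^sub>M borel)"
    unfolding w_def by measurable
  have B: "0 \<le> B" using b[of 0 0] by linarith
  have int: "integrable (lborel \<Otimes>\<^sub>M lborel) (\<lambda>(\<phi>, \<psi>). w \<phi> \<psi>)"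
  proof (rule Bochner_Integration.integrable_bound)
    have "emeasure (lborel \<Otimes>\<^sub>M lborel) ({0<..<2*pi} \<times> {0<..<\<alpha>}) < \<infinity>"
      using \<alpha> by (subst lborel.emeasure_pair_measure_Times) (auto simp: ennreal_mult_less_top)
    then show "integrable (lborel \<Otimes>\<^sub>M lborel) (\<lambda>p. K * B * indicator ({0<..<2*pi} \<times> {0<..<\<alpha>}) p :: real)"
      by (intro integrable_mult_right integrable_real_indicator) auto
    show "AE p in lborel \<Otimes>\<^sub>M lborel. norm (case p of (\<phi>, \<psi>) \<Rightarrow> w \<phi> \<psi>) \<le> norm (K * B * indicator ({0<..<2*pi} \<times> {0<..<\<alpha>}) p :: real)"
    proof (rule AE_I2, safe)
      fix \<phi> \<psi>
      have "sin \<psi> * K * h \<phi> \<psi> \<le> 1 * K * B" if "0 < \<psi>" "\<psi> < \<alpha>"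
        using s[OF that] K b B by (intro mult_mono) auto
      then show "norm (w \<phi> \<psi>) \<le> norm (K * B * indicator ({0<..<2*pi} \<times> {0<..<\<alpha>}) (\<phi>, \<psi>) :: real)"
        using w0[of \<phi> \<psi>] K B by (auto simp: w_def indicator_def)
    qed
  qed measurable
  have I: "(LBINT \<phi>=0..ereal (2 * pi). (LBINT \<psi>=0..ereal \<alpha>. sin \<psi> * K * h \<phi> \<psi>)) = (LBINT \<phi>. (LBINT \<psi>. w \<phi> \<psi>))"
    using \<alpha> by (simp add: interval_lebesgue_integral_def set_lebesgue_integral_def zero_ereal_def w_def mult.assoc)
  show "0 \<le> (LBINT \<phi>=0..ereal (2 * pi). (LBINT \<psi>=0..ereal \<alpha>. sin \<psi> * K * h \<phi> \<psi>))"
    unfolding I using w0 by (intro integral_nonneg_AE) auto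
  have "ennreal (LBINT \<phi>. (LBINT \<psi>. w \<phi> \<psi>)) = ennreal (\<integral>p. (case p of (\<phi>, \<psi>) \<Rightarrow> w \<phi> \<psi>) \<partial>(lborel \<Otimes>\<^sub>M lborel))"
    using lborel_pair.integral_fst[OF int] by simp
  also have "\<dots> = (\<integral>\<^sup>+p. ennreal (case p of (\<phi>, \<psi>) \<Rightarrow> w \<phi> \<psi>) \<partial>(lborel \<Otimes>\<^sub>M lborel))"
    using int w0 by (intro nn_integral_eq_integral[symmetric]) auto
  also have "\<dots> = (\<integral>\<^sup>+\<phi>. \<integral>\<^sup>+\<psi>. ennreal (w \<phi> \<psi>) \<partial>lborel \<partial>lborel)"
    by (subst lborel.nn_integral_fst[symmetric]) auto
  also have "\<dots> = (\<integral>\<^sup>+\<phi>. \<integral>\<^sup>+\<psi>. ennreal (indicator {0<..<2*pi} \<phi> * indicator {0<..<\<alpha>} \<psi> * (sin \<psi> * K)) * ennreal (h \<phi> \<psi>) \<partial>lborel \<partial>lborel)"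
    using s K b by (intro nn_integral_cong) (auto simp: w_def indicator_def ennreal_mult[symmetric])
  finally show "(\<integral>\<^sup>+\<phi>. \<integral>\<^sup>+\<psi>. ennreal (indicator {0<..<2*pi} \<phi> * indicator {0<..<\<alpha>} \<psi> * (sin \<psi> * K)) * ennreal (h \<phi> \<psi>) \<partial>lborel \<partial>lborel)
     = ennreal (LBINT \<phi>=0..ereal (2 * pi). (LBINT \<psi>=0..ereal \<alpha>. sin \<psi> * K * h \<phi> \<psi>))"
    unfolding I by simp
qed


text \<open>Archimedes: the area of a cap is proportional to its height, here R (1 - cos \<alpha>)
  out of the diameter 2 R.\<close>

lemma emeasure_spherical_cap:
  assumes c: "c \<noteq> 0" and R: "R > 0" and \<alpha>: "0 \<le> \<alpha>" "\<alpha> \<le> pi"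
  shows "emeasure (uniform_sphere R) (spherical_cap R c \<alpha>) = ennreal ((1 - cos \<alpha>) / 2)"
proof -
  obtain Q :: "real^3 \<Rightarrow> real^3" where Q: "orthogonal_transformation Q" "Q (axis 3 1) = c /\<^sub>R norm c"
    using ex_orthogonal_frame[OF c c] by metis
  have "emeasure (uniform_sphere R) (spherical_cap R c \<alpha>) =
      (\<integral>\<^sup>+x. 1 * indicator (spherical_cap R c \<alpha>) x \<partial>uniform_sphere R)" by simp
  also have "\<dots> = (\<integral>\<^sup>+\<phi>. \<integral>\<^sup>+\<psi>. ennreal (indicator {0<..<2*pi} \<phi> * indicator {0<..<\<alpha>} \<psi> * (sin \<psi> * (1 / (4 * pi)))) * ennreal 1 \<partial>lborel \<partial>lborel)"
    using nn_integral_spherical_cap[OF Q c R \<alpha>, of "\<lambda>_. 1"] by simp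
  also have "\<dots> = ennreal (LBINT \<phi>=0..ereal (2 * pi). (LBINT \<psi>=0..ereal \<alpha>. sin \<psi> * (1 / (4 * pi)) * 1))"
    by (rule nn_integral_polar_rectangle(1)[where B = 1]) (use \<alpha> in auto)
  also have "(LBINT \<psi>=0..ereal \<alpha>. sin \<psi> * (1 / (4 * pi)) * 1) = (1 - cos \<alpha>) / (4 * pi)"
  proof -
    have "(LBINT \<psi>=ereal 0..ereal \<alpha>. sin \<psi> * (1 / (4 * pi)) * 1) = - cos \<alpha> * (1 / (4 * pi)) - (- cos 0 * (1 / (4 * pi)))"
      by (rule interval_integral_FTC_finite)
         (auto intro!: continuous_intros derivative_eq_intros simp: has_real_derivative_iff_has_vector_derivative[symmetric])
    then show ?thesis by (simp add: zero_ereal_def diff_divide_distrib)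
  qed
  also have "(LBINT \<phi>=0..ereal (2 * pi). (1 - cos \<alpha>) / (4 * pi)) = (1 - cos \<alpha>) / 2"
  proof -
    have "(LBINT \<phi>=ereal 0..ereal (2 * pi). (1 - cos \<alpha>) / (4 * pi)) = 2 * pi * ((1 - cos \<alpha>) / (4 * pi))"
      by (subst interval_integral_const) auto
    then show ?thesis by (simp add: zero_ereal_def)
  qed
  finally show ?thesis .
qed

lemma one_minus_cos_pos: "0 < \<alpha> \<Longrightarrow> \<alpha> \<le> pi \<Longrightarrow> 0 < 1 - cos \<alpha>" for \<alpha> :: real
  using cos_monotone_0_pi[of 0 \<alpha>] by simp

lemma sets_uniform_cap [simp, measurable_cong]: "sets (uniform_cap R c \<alpha>) = sets borel"
  and space_uniform_cap [simp]: "space (uniform_cap R c \<alpha>) = UNIV"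
  by (simp_all add: uniform_cap_def)

lemma prob_space_uniform_cap:
  assumes "c \<noteq> 0" "R > 0" "0 < \<alpha>" "\<alpha> \<le> pi"
  shows "prob_space (uniform_cap R c \<alpha>)"
  unfolding uniform_cap_def using emeasure_spherical_cap[of c R \<alpha>] one_minus_cos_pos[of \<alpha>] assms
  by (intro prob_space_uniform_measure) auto

text \<open>Dividing the sphere density sin \<psi> / (4 pi) by the mass (1 - cos \<alpha>) / 2 of
  the cap gives the density that occurs in \<open>P_out_FU\<close>.\<close>

lemma nn_integral_uniform_cap:
  fixes h :: "real^3 \<Rightarrow> real"
  assumes Q: "orthogonal_transformation Q" and Qc: "Q (axis 3 1) = c /\<^sub>R norm c" and c: "c \<noteq> 0" and R: "R > 0"
    and \<alpha>: "0 < \<alpha>" "\<alpha> \<le> pi"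
    and h[measurable]: "h \<in> borel_measurable borel" and b: "\<And>x. 0 \<le> h x" "\<And>x. h x \<le> B"
  defines "I \<equiv> (LBINT \<phi>=0..ereal (2 * pi). (LBINT \<psi>=0..ereal \<alpha>. sin \<psi> / (2 * pi * (1 - cos \<alpha>)) * h (R *\<^sub>R Q (polar_direction \<phi> \<psi>))))"
  shows "(\<integral>\<^sup>+x. ennreal (h x) \<partial>uniform_cap R c \<alpha>) = ennreal I" and "0 \<le> I"
proof -
  let ?J = "\<lambda>K. (LBINT \<phi>=0..ereal (2 * pi). (LBINT \<psi>=0..ereal \<alpha>. sin \<psi> * K * h (R *\<^sub>R Q (polar_direction \<phi> \<psi>))))"
  have pos: "0 < 1 - cos \<alpha>" using \<alpha> by (rule one_minus_cos_pos)
  have lin: "linear Q" using Q by (rule orthogonal_transformation_linear)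
  have contQ: "continuous_on UNIV Q" using lin by (simp add: linear_continuous_on linear_conv_bounded_linear)
  have T[measurable]: "(\<lambda>(\<phi>, \<psi>). R *\<^sub>R Q (polar_direction \<phi> \<psi>)) \<in> borel_measurable (borel \<Otimes>\<^sub>M borel)"
    unfolding case_prod_beta borel_prod
    by (intro borel_measurable_continuous_onI continuous_intros continuous_on_compose2[OF contQ]) auto
  have hT: "(\<lambda>(\<phi>, \<psi>). h (R *\<^sub>R Q (polar_direction \<phi> \<psi>))) \<in> borel_measurable (borel \<Otimes>\<^sub>M borel)"
    using measurable_compose[OF T h] by (simp add: case_prod_beta)
  \<comment> \<open>The integral is linear in its constant, so passing from the normalisation of the
    sphere to that of the cap is a multiplication.\<close>
  have J: "?J K = K * ?J 1" for K
  proof -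
    have "(LBINT \<psi>=0..ereal \<alpha>. sin \<psi> * K * h (R *\<^sub>R Q (polar_direction \<phi> \<psi>))) =
        K * (LBINT \<psi>=0..ereal \<alpha>. sin \<psi> * 1 * h (R *\<^sub>R Q (polar_direction \<phi> \<psi>)))" for \<phi>
      by (subst interval_lebesgue_integral_mult_right[symmetric]) (simp add: ac_simps)
    then show ?thesis by (simp only: interval_lebesgue_integral_mult_right)
  qed
  have I: "I = ?J (1 / (2 * pi * (1 - cos \<alpha>)))" by (simp add: I_def)
  show "0 \<le> I" unfolding I
    by (rule nn_integral_polar_rectangle(2)[OF _ _ _ hT, where B = B]) (use \<alpha> pos b in auto)
  have "(\<integral>\<^sup>+x. ennreal (h x) \<partial>uniform_cap R c \<alpha>) = (\<integral>\<^sup>+x. ennreal (h x) * indicator (spherical_cap R c \<alpha>) x \<partial>uniform_sphere R) / ennreal ((1 - cos \<alpha>) / 2)"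
    unfolding uniform_cap_def using \<alpha> emeasure_spherical_cap[OF c R, of \<alpha>]
    by (subst nn_integral_uniform_measure) auto
  also have "(\<integral>\<^sup>+x. ennreal (h x) * indicator (spherical_cap R c \<alpha>) x \<partial>uniform_sphere R) = ennreal (?J (1 / (4 * pi)))"
    using nn_integral_spherical_cap[OF Q Qc c R, of \<alpha> "\<lambda>x. ennreal (h x)"] \<alpha>
      nn_integral_polar_rectangle(1)[OF _ _ _ hT, of \<alpha> "1 / (4 * pi)" B] b by simp
  also have "?J (1 / (4 * pi)) = I * ((1 - cos \<alpha>) / 2)"
    unfolding I using pos by (subst (1 2) J) (simp add: field_simps)
  also have "ennreal (I * ((1 - cos \<alpha>) / 2)) / ennreal ((1 - cos \<alpha>) / 2) = ennreal I"
    using pos \<open>0 \<le> I\<close> by (simp add: divide_ennreal)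
  finally show "(\<integral>\<^sup>+x. ennreal (h x) \<partial>uniform_cap R c \<alpha>) = ennreal I" .
qed

section \<open>Link distances, and the follower outage as an average over a cap\<close>

lemma r_FU_eq_dist:
  assumes Q: "orthogonal_transformation Q" and u: "norm u = R_earth" "R_earth > 0"
    and Qu: "u /\<^sub>R norm u = sin \<theta> *\<^sub>R Q (axis 1 1) + cos \<theta> *\<^sub>R Q (axis 3 1)"
  shows "r_FU R_earth R_sat \<theta> \<psi> \<phi> = dist u (R_sat *\<^sub>R Q (polar_direction \<phi> \<psi>))"
proof -
  let ?d = "polar_direction \<phi> \<psi>"
  have QQ: "Q x \<bullet> Q y = x \<bullet> y" for x y using Q by (simp add: orthogonal_transformation_def)
  \<comment> \<open>In the frame of the leader the second coordinate of the user is zero; the law of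
    cosines does the rest.\<close>
  have "u = R_earth *\<^sub>R (u /\<^sub>R norm u)" using u by simp
  then have ue: "u = R_earth *\<^sub>R (sin \<theta> *\<^sub>R Q (axis 1 1) + cos \<theta> *\<^sub>R Q (axis 3 1))" unfolding Qu .
  have "u \<bullet> Q ?d = R_earth * (sin \<theta> * sin \<psi> * cos \<phi> + cos \<theta> * cos \<psi>)"
    by (subst ue) (simp add: inner_add_left QQ inner_axis')
  moreover have "Q ?d \<bullet> Q ?d = 1" unfolding QQ by (simp add: norm_eq_1[symmetric])
  moreover have "u \<bullet> u = R_earth\<^sup>2" using u by (simp add: dot_square_norm)
  ultimately show ?thesis
    unfolding r_FU_def dist_norm norm_eq_sqrt_inner
    by (simp add: inner_diff_left inner_diff_right inner_commute[of "Q ?d" u] power2_eq_square algebra_simps)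
qed

lemma r_LU_eq_dist:
  assumes "norm c = R_sat" "R_sat > 0" "norm u = R_earth" "R_earth > 0"
  shows "r_LU R_earth R_sat (central_angle c u) = dist u c"
proof -
  have "R_sat\<^sup>2 + R_earth\<^sup>2 - 2 * R_sat * R_earth * ((c \<bullet> u) / (norm c * norm u)) = (norm (u - c))\<^sup>2"
    using assms dot_norm_neg[of u c] by (simp add: inner_commute[of c u])
  then show ?thesis unfolding r_LU_def cos_central_angle dist_norm by simp
qed

text \<open>The right-hand side sees \<open>c\<close> only through its central angle to the user.
  This is what reduces conditioning on all leader positions to conditioning on the contact
  angle.\<close>

lemma P_out_FU_eq_nn_integral:
  assumes F: "continuous_on {0..} F" "\<And>t. 0 \<le> t \<Longrightarrow> 0 \<le> F t" "\<And>t. 0 \<le> t \<Longrightarrow> F t \<le> 1"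
    and pos: "0 < \<gamma>" "0 < \<xi>"
    and c: "norm c = R_sat" "R_sat > 0" and u: "norm u = R_earth" "R_earth > 0"
    and \<alpha>: "0 < \<alpha>" "\<alpha> \<le> pi"
  shows "(\<integral>\<^sup>+x. ennreal (F (\<gamma> * (dist u x)\<^sup>2 / \<xi>)) \<partial>uniform_cap R_sat c \<alpha>)
      = ennreal (P_out_FU F \<gamma> \<xi> R_earth R_sat \<alpha> (central_angle c u))"
    and "0 \<le> P_out_FU F \<gamma> \<xi> R_earth R_sat \<alpha> (central_angle c u)"
proof -
  have c0: "c \<noteq> 0" and u0: "u \<noteq> 0" using c u by auto
  obtain Q :: "real^3 \<Rightarrow> real^3" where Q: "orthogonal_transformation Q" "Q (axis 3 1) = c /\<^sub>R norm c"
    and Qu: "u /\<^sub>R norm u = sin (central_angle c u) *\<^sub>R Q (axis 1 1) + cos (central_angle c u) *\<^sub>R Q (axis 3 1)"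
    using ex_orthogonal_frame[OF c0 u0] by metis
  have "continuous_on UNIV (\<lambda>x. F (\<gamma> * (dist u x)\<^sup>2 / \<xi>))"
    by (rule continuous_on_compose2[OF F(1)]) (use pos in \<open>auto intro!: continuous_intros\<close>)
  then have m: "(\<lambda>x. F (\<gamma> * (dist u x)\<^sup>2 / \<xi>)) \<in> borel_measurable borel"
    by (rule borel_measurable_continuous_onI)
  have arg: "0 \<le> \<gamma> * (dist u x)\<^sup>2 / \<xi>" for x using pos by simp
  note I = nn_integral_uniform_cap[OF Q c0 c(2) \<alpha> m, of 1]
  have P: "P_out_FU F \<gamma> \<xi> R_earth R_sat \<alpha> (central_angle c u) =
    (LBINT \<phi>=0..ereal (2 * pi). (LBINT \<psi>=0..ereal \<alpha>. sin \<psi> / (2 * pi * (1 - cos \<alpha>)) * F (\<gamma> * (dist u (R_sat *\<^sub>R Q (polar_direction \<phi> \<psi>)))\<^sup>2 / \<xi>)))"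
    unfolding P_out_FU_def r_FU_eq_dist[OF Q(1) u Qu] ..
  show "(\<integral>\<^sup>+x. ennreal (F (\<gamma> * (dist u x)\<^sup>2 / \<xi>)) \<partial>uniform_cap R_sat c \<alpha>)
      = ennreal (P_out_FU F \<gamma> \<xi> R_earth R_sat \<alpha> (central_angle c u))"
    unfolding P using I F(2,3)[OF arg] by simp
  show "0 \<le> P_out_FU F \<gamma> \<xi> R_earth R_sat \<alpha> (central_angle c u)"
    unfolding P using I F(2,3)[OF arg] by simp
qed

subsection \<open>Conditional probabilities\<close>

context prob_space
begin

lemma finite_measure_subalgebra_vimage:
  assumes "Y \<in> M \<rightarrow>\<^sub>M N"
  shows "finite_measure_subalgebra M (vimage_algebra (space M) Y N)"
proof -
  have "subalgebra M (vimage_algebra (space M) Y N)"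
    using assms measurable_iff_sets[of Y M N] by (auto simp: subalgebra_def measurable_def)
  then show ?thesis
    by (intro finite_measure_subalgebra.intro finite_measure_subalgebra_axioms.intro) unfold_locales
qed

lemma cond_prob_rv_int:
  assumes Y: "Y \<in> M \<rightarrow>\<^sub>M N" and E: "E \<in> events" and B: "B \<in> sets N"
  shows "prob {\<omega> \<in> E. Y \<omega> \<in> B} = (\<integral>\<omega>. indicator B (Y \<omega>) * cond_prob_rv M N Y E \<omega> \<partial>M)"
proof -
  let ?G = "vimage_algebra (space M) Y N"
  interpret G: finite_measure_subalgebra M ?G using Y by (rule finite_measure_subalgebra_vimage)
  have A: "Y -` B \<inter> space M \<in> sets ?G" using B by (rule in_vimage_algebra)
  have int: "integrable M (indicat_real E)" using E by (intro integrable_real_indicator) (auto simp: less_top[symmetric])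
  have "(LINT \<omega>:(Y -` B \<inter> space M)|M. indicat_real E \<omega>) = (LINT \<omega>:(Y -` B \<inter> space M)|M. cond_prob_rv M N Y E \<omega>)"
    unfolding cond_prob_rv_def by (rule G.real_cond_exp_intA[OF int A])
  moreover have "(LINT \<omega>:(Y -` B \<inter> space M)|M. indicat_real E \<omega>) = prob {\<omega> \<in> E. Y \<omega> \<in> B}"
  proof -
    have S: "{\<omega> \<in> E. Y \<omega> \<in> B} = E \<inter> (Y -` B \<inter> space M)" using sets.sets_into_space[OF E] by auto
    have "(LINT \<omega>:(Y -` B \<inter> space M)|M. indicat_real E \<omega>) = (\<integral>\<omega>. indicat_real (E \<inter> (Y -` B \<inter> space M)) \<omega> \<partial>M)"
      unfolding set_lebesgue_integral_def by (intro Bochner_Integration.integral_cong) (auto simp: indicator_def)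
    also have "\<dots> = prob (E \<inter> (Y -` B \<inter> space M))" using E Y B by (simp add: measurable_sets sets.Int)
    finally show ?thesis unfolding S .
  qed
  moreover have "(LINT \<omega>:(Y -` B \<inter> space M)|M. cond_prob_rv M N Y E \<omega>) = (\<integral>\<omega>. indicator B (Y \<omega>) * cond_prob_rv M N Y E \<omega> \<partial>M)"
    unfolding set_lebesgue_integral_def by (intro Bochner_Integration.integral_cong) (auto simp: indicator_def)
  ultimately show ?thesis by simp
qed

text \<open>Every set of the sigma-algebra generated by \<open>Y\<close> is the preimage of some
  \<open>B\<close>, so integrals over such preimages determine the conditional probability. The
  hypothesis is phrased with \<open>emeasure\<close> because \<open>emeasure_outage\<close> delivers
  it in that form.\<close>

lemma AE_cond_prob_rvI:
  fixes g :: "'b \<Rightarrow> real"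
  assumes Y[measurable]: "Y \<in> M \<rightarrow>\<^sub>M N" and E[measurable]: "E \<in> events" and g[measurable]: "g \<in> borel_measurable N"
    and nonneg: "\<And>\<omega>. \<omega> \<in> space M \<Longrightarrow> 0 \<le> g (Y \<omega>)"
    and eq: "\<And>B. B \<in> sets N \<Longrightarrow> emeasure M {\<omega> \<in> E. Y \<omega> \<in> B} = (\<integral>\<^sup>+\<omega>. indicator B (Y \<omega>) * ennreal (g (Y \<omega>)) \<partial>M)"
  shows "AE \<omega> in M. cond_prob_rv M N Y E \<omega> = g (Y \<omega>)"
proof -
  let ?G = "vimage_algebra (space M) Y N"
  interpret G: finite_measure_subalgebra M ?G using Y by (rule finite_measure_subalgebra_vimage)
  have int_E: "integrable M (indicat_real E)" using E by (intro integrable_real_indicator) (auto simp: less_top[symmetric])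
  \<comment> \<open>Taking the whole space for \<open>B\<close> bounds this integral by the
    probability of \<open>E\<close>, which gives integrability.\<close>
  have "(\<integral>\<^sup>+\<omega>. ennreal (g (Y \<omega>)) \<partial>M) = (\<integral>\<^sup>+\<omega>. indicator (space N) (Y \<omega>) * ennreal (g (Y \<omega>)) \<partial>M)"
    using Y by (intro nn_integral_cong) (auto simp: indicator_def measurable_def)
  also have "\<dots> < \<infinity>" unfolding eq[OF sets.top, symmetric] by (simp add: less_top[symmetric])
  finally have int_g: "integrable M (\<lambda>\<omega>. g (Y \<omega>))"
    using nonneg by (intro integrableI_nonneg) auto
  show ?thesis unfolding cond_prob_rv_def
  proof (rule G.real_cond_exp_charact[OF _ int_E int_g])
    show "(\<lambda>\<omega>. g (Y \<omega>)) \<in> borel_measurable ?G"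
      using measurable_compose[OF measurable_vimage_algebra1 g, of Y "space M"] Y by (auto simp: measurable_def)
    fix A assume "A \<in> sets ?G"
    then obtain B where B: "B \<in> sets N" and A: "A = Y -` B \<inter> space M"
      using Y by (auto simp: sets_vimage_algebra2 measurable_def)
    have A_ev: "A \<in> events" unfolding A using Y B by (rule measurable_sets)
    have "ennreal (LINT \<omega>:A|M. g (Y \<omega>)) = (\<integral>\<^sup>+\<omega>. ennreal (indicator A \<omega> * g (Y \<omega>)) \<partial>M)"
      unfolding set_lebesgue_integral_def real_scaleR_def using nonneg int_g A_ev
      by (intro nn_integral_eq_integral[symmetric] AE_I2) (auto intro: integrable_real_mult_indicator simp: mult.commute[of "indicator A _"])
    also have "\<dots> = (\<integral>\<^sup>+\<omega>. indicator B (Y \<omega>) * ennreal (g (Y \<omega>)) \<partial>M)"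
      by (intro nn_integral_cong) (auto simp: A indicator_def)
    also have "\<dots> = emeasure M {\<omega> \<in> E. Y \<omega> \<in> B}" using eq[OF B] by simp
    also have "\<dots> = ennreal (prob {\<omega> \<in> E. Y \<omega> \<in> B})" by (simp add: emeasure_eq_measure)
    finally have "ennreal (LINT \<omega>:A|M. g (Y \<omega>)) = ennreal (prob {\<omega> \<in> E. Y \<omega> \<in> B})" .
    moreover have "0 \<le> (LINT \<omega>:A|M. g (Y \<omega>))"
      unfolding set_lebesgue_integral_def using nonneg by (intro integral_nonneg_AE AE_I2) auto
    ultimately have "(LINT \<omega>:A|M. g (Y \<omega>)) = prob {\<omega> \<in> E. Y \<omega> \<in> B}" by simp
    moreover have "(LINT \<omega>:A|M. indicat_real E \<omega>) = prob {\<omega> \<in> E. Y \<omega> \<in> B}"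
    proof -
      have S: "{\<omega> \<in> E. Y \<omega> \<in> B} = E \<inter> A" using sets.sets_into_space[OF E] by (auto simp: A)
      have "(LINT \<omega>:A|M. indicat_real E \<omega>) = (\<integral>\<omega>. indicat_real (E \<inter> A) \<omega> \<partial>M)"
        unfolding set_lebesgue_integral_def by (intro Bochner_Integration.integral_cong) (auto simp: indicator_def)
      also have "\<dots> = prob (E \<inter> A)" using E A_ev by simp
      finally show ?thesis unfolding S .
    qed
    ultimately show "(LINT \<omega>:A|M. indicat_real E \<omega>) = (LINT \<omega>:A|M. g (Y \<omega>))" by simp
  qed
qed

text \<open>Conditional independence in integrated form, with the conditional probability replaced
  by its almost sure value. Measurability of the product is a hypothesis because \<open>K\<close> is
  an arbitrary family of measures here.\<close>

lemma prob_cond_iid_given: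
  assumes cond: "cond_iid_given M N Y I X K" and Y: "Y \<in> M \<rightarrow>\<^sub>M N" and I: "finite I"
    and C: "\<And>i. i \<in> I \<Longrightarrow> C i \<in> sets borel" and B: "B \<in> sets N"
    and K: "(\<lambda>\<omega>. \<Prod>i\<in>I. measure (K \<omega>) (C i)) \<in> borel_measurable M"
  shows "prob {\<omega> \<in> space M. Y \<omega> \<in> B \<and> (\<forall>i\<in>I. X i \<omega> \<in> C i)} =
    (\<integral>\<omega>. indicator B (Y \<omega>) * (\<Prod>i\<in>I. measure (K \<omega>) (C i)) \<partial>M)"
proof -
  have X[measurable]: "X i \<in> borel_measurable M" if "i \<in> I" for i using cond that by (simp add: cond_iid_given_def)
  let ?E = "{\<omega> \<in> space M. \<forall>i\<in>I. X i \<omega> \<in> C i}"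
  have "?E = (\<Inter>i\<in>I. X i -` C i \<inter> space M) \<inter> space M" by auto
  also have "\<dots> \<in> events"
  proof (cases "I = {}")
    case False
    then show ?thesis using I by (intro sets.Int sets.finite_INT measurable_sets[OF X C]) auto
  qed auto
  finally have E: "?E \<in> events" .
  have ae: "AE \<omega> in M. cond_prob_rv M N Y ?E \<omega> = (\<Prod>i\<in>I. measure (K \<omega>) (C i))"
    using cond C by (simp add: cond_iid_given_def)
  have "{\<omega> \<in> space M. Y \<omega> \<in> B \<and> (\<forall>i\<in>I. X i \<omega> \<in> C i)} = {\<omega> \<in> ?E. Y \<omega> \<in> B}" by auto
  then have "prob {\<omega> \<in> space M. Y \<omega> \<in> B \<and> (\<forall>i\<in>I. X i \<omega> \<in> C i)} = (\<integral>\<omega>. indicator B (Y \<omega>) * cond_prob_rv M N Y ?E \<omega> \<partial>M)"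
    using cond_prob_rv_int[OF Y E B] by simp
  also have "\<dots> = (\<integral>\<omega>. indicator B (Y \<omega>) * (\<Prod>i\<in>I. measure (K \<omega>) (C i)) \<partial>M)"
  proof (rule integral_cong_AE)
    have [measurable]: "(\<lambda>\<omega>. indicat_real B (Y \<omega>)) \<in> borel_measurable M" using Y B by measurable
    show "(\<lambda>\<omega>. indicat_real B (Y \<omega>) * cond_prob_rv M N Y ?E \<omega>) \<in> borel_measurable M"
      unfolding cond_prob_rv_def by measurable
    show "(\<lambda>\<omega>. indicat_real B (Y \<omega>) * (\<Prod>i\<in>I. measure (K \<omega>) (C i))) \<in> borel_measurable M"
      using K by measurable
  qed (use ae in auto)
  finally show ?thesis .
qed

text \<open>The joint law and the product law agree on rectangles. This lets the fading and the
  positions, which take values in different spaces, be integrated one at a time.\<close>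

lemma distr_indep_rvs:
  assumes "indep_rvs M N Y N' Y'"
  shows "distr M (N \<Otimes>\<^sub>M N') (\<lambda>\<omega>. (Y \<omega>, Y' \<omega>)) = distr M N Y \<Otimes>\<^sub>M distr M N' Y'"
proof -
  have Y[measurable]: "Y \<in> M \<rightarrow>\<^sub>M N" and Y'[measurable]: "Y' \<in> M \<rightarrow>\<^sub>M N'"
    and ind: "indep_set (sets (vimage_algebra (space M) Y N)) (sets (vimage_algebra (space M) Y' N'))"
    using assms by (auto simp: indep_rvs_def)
  interpret D: prob_space "distr M N Y" by (rule prob_space_distr) fact
  interpret D': prob_space "distr M N' Y'" by (rule prob_space_distr) fact
  have "distr M N Y \<Otimes>\<^sub>M distr M N' Y' = distr M (N \<Otimes>\<^sub>M N') (\<lambda>\<omega>. (Y \<omega>, Y' \<omega>))"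
  proof (rule pair_measure_eqI)
    fix A B assume "A \<in> sets (distr M N Y)" "B \<in> sets (distr M N' Y')"
    then have A[measurable]: "A \<in> sets N" and B[measurable]: "B \<in> sets N'" by auto
    have "prob ((Y -` A \<inter> space M) \<inter> (Y' -` B \<inter> space M)) = prob (Y -` A \<inter> space M) * prob (Y' -` B \<inter> space M)"
      using ind by (rule indep_setD) (auto intro: in_vimage_algebra)
    moreover have "(\<lambda>\<omega>. (Y \<omega>, Y' \<omega>)) -` (A \<times> B) \<inter> space M = (Y -` A \<inter> space M) \<inter> (Y' -` B \<inter> space M)" by auto
    ultimately show "emeasure (distr M N Y) A * emeasure (distr M N' Y') B =
        emeasure (distr M (N \<Otimes>\<^sub>M N') (\<lambda>\<omega>. (Y \<omega>, Y' \<omega>))) (A \<times> B)"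
      by (simp add: emeasure_distr emeasure_eq_measure ennreal_mult[symmetric])
  next
    have "sets (distr M N Y \<Otimes>\<^sub>M distr M N' Y') = sets (N \<Otimes>\<^sub>M N')"
      by (rule sets_pair_measure_cong) simp_all
    then show "sets (distr M N Y \<Otimes>\<^sub>M distr M N' Y') = sets (distr M (N \<Otimes>\<^sub>M N') (\<lambda>\<omega>. (Y \<omega>, Y' \<omega>)))"
      by simp
  qed (rule D.sigma_finite_measure_axioms D'.sigma_finite_measure_axioms)+
  then show ?thesis ..
qed

end

section \<open>Measurability of the nearest leader and of cap probabilities\<close>

lemma arg_min_on_cong:
  assumes "\<And>j. j \<in> S \<Longrightarrow> f j = g j" shows "arg_min_on f S = arg_min_on g S"
proof -
  \<comment> \<open>\<open>arg_min_on\<close> chooses from this predicate, so equal predicates give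
    the same choice even when there are ties.\<close>
  have "is_arg_min f (\<lambda>x. x \<in> S) = is_arg_min g (\<lambda>x. x \<in> S)"
    using assms by (auto simp: is_arg_min_def fun_eq_iff)
  then show ?thesis by (simp add: arg_min_on_def arg_min_def)
qed

text \<open>Ties are broken by a choice operator of which nothing else is known. The chosen index is
  still measurable, because it is a function of the set \<open>D\<close> of minimising indices and
  only finitely many sets \<open>D\<close> can occur.\<close>

lemma measurable_arg_min_on_apply:
  fixes N :: nat and u :: "real^3"
  assumes "N \<ge> 1"
  shows "(\<lambda>p. p (arg_min_on (\<lambda>j. dist (p j) u) {1..N})) \<in> (\<Pi>\<^sub>M j\<in>{1..N}. borel) \<rightarrow>\<^sub>M (borel :: (real^3) measure)"
proof -
  let ?S = "{1..N}" and ?P = "\<Pi>\<^sub>M j\<in>{1..N}. borel :: (real^3) measure"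
  have fin: "finite ?S" "?S \<noteq> {}" using assms by auto
  have g: "(\<lambda>p. arg_min_on (\<lambda>j. dist (p j) u) ?S) \<in> ?P \<rightarrow>\<^sub>M count_space ?S"
  proof (subst measurable_count_space_eq2[OF fin(1)], intro conjI ballI)
    show "(\<lambda>p. arg_min_on (\<lambda>j. dist (p j) u) ?S) \<in> space ?P \<rightarrow> ?S"
    proof
      fix p
      show "arg_min_on (\<lambda>j. dist (p j) u) ?S \<in> ?S" by (rule arg_min_if_finite(1)[OF fin])
    qed
    fix k assume "k \<in> ?S"
    have "arg_min_on (\<lambda>j. dist (p j) u) ?S = k \<longleftrightarrow>
        (\<exists>D\<in>Pow ?S. (SOME i. i \<in> D) = k \<and> (\<forall>i\<in>?S. i \<in> D \<longleftrightarrow> (\<forall>j\<in>?S. dist (p i) u \<le> dist (p j) u)))" for p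
    proof -
      define D where "D = {i \<in> ?S. \<forall>j\<in>?S. dist (p i) u \<le> dist (p j) u}"
      have "arg_min_on (\<lambda>j. dist (p j) u) ?S = (SOME i. i \<in> D)"
        by (auto simp: arg_min_on_def arg_min_def is_arg_min_def D_def not_less intro!: arg_cong[where f = Eps])
      moreover have "D' = D" if "D' \<in> Pow ?S" "\<forall>i\<in>?S. i \<in> D' \<longleftrightarrow> (\<forall>j\<in>?S. dist (p i) u \<le> dist (p j) u)" for D'
        using that by (auto simp: D_def)
      moreover have "D \<in> Pow ?S" "\<forall>i\<in>?S. i \<in> D \<longleftrightarrow> (\<forall>j\<in>?S. dist (p i) u \<le> dist (p j) u)" by (auto simp: D_def)
      ultimately show ?thesis by metis
    qed
    then have "(\<lambda>p. arg_min_on (\<lambda>j. dist (p j) u) ?S) -` {k} \<inter> space ?P =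
        {p \<in> space ?P. \<exists>D\<in>Pow ?S. (SOME i. i \<in> D) = k \<and> (\<forall>i\<in>?S. i \<in> D \<longleftrightarrow> (\<forall>j\<in>?S. dist (p i) u \<le> dist (p j) u))}"
      by auto
    also have "\<dots> \<in> sets ?P"
    proof (intro sets.sets_Collect_finite_Ex sets.sets_Collect_conj sets.sets_Collect_finite_All sets.sets_Collect_const)
      fix D and i assume "i \<in> ?S"
      have le: "{p \<in> space ?P. \<forall>j\<in>?S. dist (p i) u \<le> dist (p j) u} \<in> sets ?P"
      proof (rule sets.sets_Collect_finite_All)
        fix j assume "j \<in> ?S"
        then have [measurable]: "(\<lambda>p. p i) \<in> ?P \<rightarrow>\<^sub>M borel" "(\<lambda>p. p j) \<in> ?P \<rightarrow>\<^sub>M borel"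
          using \<open>i \<in> ?S\<close> by (auto intro: measurable_component_singleton)
        show "{p \<in> space ?P. dist (p i) u \<le> dist (p j) u} \<in> sets ?P" by measurable
      qed simp
      show "{p \<in> space ?P. (i \<in> D) = (\<forall>j\<in>?S. dist (p i) u \<le> dist (p j) u)} \<in> sets ?P"
        using le sets.sets_Collect_neg[OF le] by (cases "i \<in> D") (simp_all only: simp_thms)
    qed auto
    finally show "(\<lambda>p. arg_min_on (\<lambda>j. dist (p j) u) ?S) -` {k} \<inter> space ?P \<in> sets ?P" .
  qed
  \<comment> \<open>A measurable index with finitely many values selects measurably among the
    coordinates.\<close>
  show ?thesis
    by (rule measurable_compose_countable'[OF _ g, where f = "\<lambda>i p. p i"]) auto
qed

text \<open>Written as a quotient of two masses under the fixed measure
  \<open>uniform_sphere R\<close>, the cap probability no longer has a varying measure; numerator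
  and denominator are masses of sections of measurable sets.\<close>

lemma measurable_emeasure_uniform_cap:
  assumes c[measurable]: "c \<in> borel_measurable N" and S: "Measurable.pred (N \<Otimes>\<^sub>M borel) (\<lambda>(y, x). S y x)"
  shows "(\<lambda>y. emeasure (uniform_cap R (c y) \<alpha>) {x. S y x}) \<in> borel_measurable N"
proof -
  interpret U: prob_space "uniform_sphere R" by (rule prob_space_uniform_sphere)
  note S[measurable]
  have slice: "{x. S y x} \<in> sets borel" if "y \<in> space N" for y
  proof -
    have "{x \<in> space borel. case (y, x) of (y, x) \<Rightarrow> S y x} \<in> sets borel"
      using that by measurable
    then show ?thesis by simp
  qed
  have cap[measurable]: "Measurable.pred (N \<Otimes>\<^sub>M borel) (\<lambda>z. snd z \<in> spherical_cap R (c (fst z)) \<alpha>)"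
    unfolding spherical_cap_def by simp measurable
  have S'[measurable]: "Measurable.pred (N \<Otimes>\<^sub>M borel) (\<lambda>z. S (fst z) (snd z))"
    using S by (simp add: case_prod_beta')
  let ?Q = "{z \<in> space (N \<Otimes>\<^sub>M uniform_sphere R). snd z \<in> spherical_cap R (c (fst z)) \<alpha>}"
  let ?Q' = "{z \<in> space (N \<Otimes>\<^sub>M uniform_sphere R). snd z \<in> spherical_cap R (c (fst z)) \<alpha> \<and> S (fst z) (snd z)}"
  have 1: "(\<lambda>y. emeasure (uniform_sphere R) (Pair y -` ?Q)) \<in> borel_measurable N"
    by (rule U.measurable_emeasure_Pair) measurable
  have 2: "(\<lambda>y. emeasure (uniform_sphere R) (Pair y -` ?Q')) \<in> borel_measurable N"
    by (rule U.measurable_emeasure_Pair) measurable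
  have "(\<lambda>y. emeasure (uniform_sphere R) (Pair y -` ?Q') / emeasure (uniform_sphere R) (Pair y -` ?Q)) \<in> borel_measurable N"
    using 1 2 by measurable
  also have "?this \<longleftrightarrow> ?thesis"
  proof (rule measurable_cong)
    fix y assume y: "y \<in> space N"
    have "Pair y -` ?Q' = spherical_cap R (c y) \<alpha> \<inter> {x. S y x}" "Pair y -` ?Q = spherical_cap R (c y) \<alpha>"
      using y by (auto simp: space_pair_measure)
    then show "emeasure (uniform_sphere R) (Pair y -` ?Q') / emeasure (uniform_sphere R) (Pair y -` ?Q) =
      emeasure (uniform_cap R (c y) \<alpha>) {x. S y x}"
      using slice[OF y] by (simp add: uniform_cap_def sets_spherical_cap)
  qed
  finally show ?thesis .
qed

lemma borel_measurable_P_out_FU: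
  assumes F: "continuous_on {0..} F" and pos: "0 < \<gamma>" "0 < \<xi>" and \<alpha>: "0 < \<alpha>"
  shows "P_out_FU F \<gamma> \<xi> R_earth R_sat \<alpha> \<in> borel_measurable borel"
proof -
  \<comment> \<open>\<open>F\<close> is continuous on the nonnegative axis only; it is continued by
    the constant \<open>F 0\<close>, which does not affect the nonnegative arguments that
    occur.\<close>
  have "continuous_on UNIV (\<lambda>t. F (max 0 t))"
    by (rule continuous_on_compose2[OF F]) (auto intro!: continuous_intros)
  then have [measurable]: "(\<lambda>t. F (max 0 t)) \<in> borel_measurable borel" by (rule borel_measurable_continuous_onI)
  have F_eq: "F (\<gamma> * x\<^sup>2 / \<xi>) = F (max 0 (\<gamma> * x\<^sup>2 / \<xi>))" for x using pos by (simp add: max_def)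
  show ?thesis
    unfolding P_out_FU_def r_FU_def F_eq interval_lebesgue_integral_def set_lebesgue_integral_def
    using \<alpha> by (simp add: zero_ereal_def) measurable
qed

subsection \<open>Outage probability given the contact angle\<close>

text \<open>The link constants form one family, with index 0 for the leader link, so that all links
  can be handled together. The fading law is kept abstract: a distribution function that is
  continuous on the nonnegative axis.\<close>

locale satellite_cluster = prob_space M for M :: "'a measure" +
  fixes R_earth R_sat \<theta>_cap \<gamma> :: real and u :: "real^3" and N_L N_F :: nat
    and L X :: "nat \<Rightarrow> 'a \<Rightarrow> real^3" and W :: "nat \<Rightarrow> 'a \<Rightarrow> real" and \<xi> :: "nat \<Rightarrow> real" and F :: "real \<Rightarrow> real"
  assumes R_earth: "0 < R_earth" and R_sat: "R_earth < R_sat" and norm_u: "norm u = R_earth" and N_L: "1 \<le> N_L"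
    and \<theta>_cap: "0 < \<theta>_cap" "\<theta>_cap \<le> pi"
    and leaders_indep: "indep_vars (\<lambda>_. borel) L {1..N_L}"
    and leaders_uniform: "j \<in> {1..N_L} \<Longrightarrow> distr M borel (L j) = uniform_sphere R_sat"
    and followers: "cond_iid_given M (\<Pi>\<^sub>M j\<in>{1..N_L}. borel) (leader_positions N_L L) {1..N_F} X
          (\<lambda>\<omega>. uniform_cap R_sat (associated_leader N_L L u \<omega>) \<theta>_cap)"
    and fading_indep: "indep_vars (\<lambda>_. borel) W {0..N_F}"
    and fading_cdf: "i \<in> {0..N_F} \<Longrightarrow> 0 \<le> w \<Longrightarrow> cdf (distr M borel (W i)) w = F w"
    and fading_indep_positions: "indep_rvs M
         (\<Pi>\<^sub>M i\<in>{0..N_F}. borel) (\<lambda>\<omega>. \<lambda>i\<in>{0..N_F}. W i \<omega>)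
         ((\<Pi>\<^sub>M j\<in>{1..N_L}. borel) \<Otimes>\<^sub>M (\<Pi>\<^sub>M i\<in>{1..N_F}. borel))
         (\<lambda>\<omega>. (leader_positions N_L L \<omega>, \<lambda>i\<in>{1..N_F}. X i \<omega>))"
    and F_cont: "continuous_on {0..} F" and \<gamma>: "0 < \<gamma>" and \<xi>: "0 < \<xi> i"
begin

abbreviation "N_P \<equiv> \<Pi>\<^sub>M j\<in>{1..N_L}. (borel :: (real^3) measure)"
abbreviation "pos \<equiv> leader_positions N_L L"
abbreviation "lead \<equiv> associated_leader N_L L u"
abbreviation "\<theta> \<equiv> contact_angle N_L L u"
abbreviation "\<mu> j \<equiv> distr M borel (W j)"
abbreviation "K \<omega> \<equiv> uniform_cap R_sat (lead \<omega>) \<theta>_cap"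

text \<open>The associated leader as a function of the position vector alone, so that events about
  it become events of the variable on which the followers are conditioned.\<close>

definition nearest :: "(nat \<Rightarrow> real^3) \<Rightarrow> real^3" where
  "nearest p = p (arg_min_on (\<lambda>j. dist (p j) u) {1..N_L})"

lemma R_sat_pos: "0 < R_sat" using R_earth R_sat by linarith

lemma lead_eq_nearest: "lead \<omega> = nearest (pos \<omega>)"
proof -
  have "arg_min_on (\<lambda>j. dist (pos \<omega> j) u) {1..N_L} = arg_min_on (\<lambda>j. dist (L j \<omega>) u) {1..N_L}"
    by (rule arg_min_on_cong) (simp add: leader_positions_def)
  moreover have "arg_min_on (\<lambda>j. dist (L j \<omega>) u) {1..N_L} \<in> {1..N_L}"
    by (rule arg_min_if_finite(1)) (use N_L in auto)
  ultimately show ?thesis by (simp add: nearest_def associated_leader_def leader_positions_def)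
qed

lemma measurable_nearest [measurable]: "nearest \<in> N_P \<rightarrow>\<^sub>M borel"
  unfolding nearest_def by (rule measurable_arg_min_on_apply[OF N_L])

lemma measurable_W: "j \<in> {0..N_F} \<Longrightarrow> W j \<in> borel_measurable M"
  and measurable_L: "j \<in> {1..N_L} \<Longrightarrow> L j \<in> borel_measurable M"
  using fading_indep leaders_indep by (simp_all add: indep_vars_def)

lemma measurable_X: "i \<in> {1..N_F} \<Longrightarrow> X i \<in> borel_measurable M"
  using followers by (auto simp: cond_iid_given_def)

lemma measurable_pos [measurable]: "pos \<in> M \<rightarrow>\<^sub>M N_P"
  unfolding leader_positions_def using measurable_L by (rule measurable_restrict)

lemma measurable_lead [measurable]: "lead \<in> borel_measurable M"
proof -
  have "lead = (\<lambda>\<omega>. nearest (pos \<omega>))" by (rule ext) (rule lead_eq_nearest)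
  then show ?thesis using measurable_compose[OF measurable_pos measurable_nearest] by simp
qed

lemma measurable_contact_angle [measurable]: "\<theta> \<in> borel_measurable M"
  unfolding contact_angle_def by measurable

lemma AE_norm_L: "AE \<omega> in M. \<forall>j\<in>{1..N_L}. norm (L j \<omega>) = R_sat"
proof (rule AE_finite_allI)
  fix j assume j: "j \<in> {1..N_L}"
  have "AE x in distr M borel (L j). norm x = R_sat"
    unfolding leaders_uniform[OF j] using R_sat_pos by (intro AE_uniform_sphere_norm) simp
  then show "AE \<omega> in M. norm (L j \<omega>) = R_sat"
    using measurable_L[OF j] by (subst (asm) AE_distr_iff) auto
qed simp

lemma AE_norm_lead: "AE \<omega> in M. norm (lead \<omega>) = R_sat"
  using AE_norm_L
proof eventually_elim
  case (elim \<omega>)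
  have "arg_min_on (\<lambda>j. dist (L j \<omega>) u) {1..N_L} \<in> {1..N_L}"
    by (rule arg_min_if_finite(1)) (use N_L in auto)
  then show ?case using elim by (simp add: associated_leader_def)
qed

section \<open>Outage of a single link\<close>

lemma real_distribution_\<mu>: "j \<in> {0..N_F} \<Longrightarrow> real_distribution (\<mu> j)"
  using measurable_W by (rule real_distribution_distr)

lemma F_bounds: "0 \<le> t \<Longrightarrow> 0 \<le> F t" "0 \<le> t \<Longrightarrow> F t \<le> 1"
proof -
  interpret D: real_distribution "\<mu> 0" by (rule real_distribution_\<mu>) simp
  show "0 \<le> t \<Longrightarrow> 0 \<le> F t" "0 \<le> t \<Longrightarrow> F t \<le> 1"
    using fading_cdf[of 0 t] D.cdf_nonneg[of t] D.cdf_bounded_prob[of t] by simp_all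
qed

text \<open>Outage means w < t, while the distribution function concerns w \<le> t. As r > 0 makes t
  > 0, \<open>F\<close> is continuous at t and agrees with the distribution function near t, so the
  single point t carries no mass.\<close>

lemma emeasure_fading:
  assumes j: "j \<in> {0..N_F}" and r: "0 < r" and c: "0 < c"
  shows "emeasure (\<mu> j) {w. snr c w r < \<gamma>} = ennreal (F (\<gamma> * r\<^sup>2 / c))"
proof -
  interpret D: real_distribution "\<mu> j" using j by (rule real_distribution_\<mu>)
  define t where "t = \<gamma> * r\<^sup>2 / c"
  have t: "0 < t" using r c \<gamma> by (simp add: t_def)
  have "{w. snr c w r < \<gamma>} = {..<t}"
    using r c by (auto simp: snr_def t_def field_simps)
  moreover have "D.prob {..<t} = F t"
  proof -
    have "isCont F t"
      using F_cont t by (intro continuous_on_interior[of "{0..}"]) (auto simp: interior_Ici[of _ "-1"])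
    moreover have "\<forall>\<^sub>F x in nhds t. cdf (\<mu> j) x = F x"
      using eventually_nhds_in_open[of "{0<..}" t] t by (auto elim!: eventually_mono simp: fading_cdf[OF j])
    ultimately have "isCont (cdf (\<mu> j)) t" by (simp add: isCont_cong)
    then have "D.prob {t} = 0" by (simp add: D.isCont_cdf)
    moreover have "D.prob {..t} = D.prob {..<t} + D.prob {t}"
      by (subst D.finite_measure_Union[symmetric]) (auto intro!: arg_cong[where f = D.prob])
    ultimately show ?thesis using fading_cdf[OF j, of t] t by (simp add: cdf_def)
  qed
  ultimately show ?thesis by (simp add: D.emeasure_eq_measure t_def)
qed

definition link_outage :: "nat \<Rightarrow> real \<Rightarrow> real" where
  "link_outage j = (if j = 0 then P_Cond_LU F \<gamma> (\<xi> 0) R_earth R_sat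
     else P_out_FU F \<gamma> (\<xi> j) R_earth R_sat \<theta>_cap)"

lemma dist_pos: "norm x = R_sat \<Longrightarrow> 0 < dist u x"
  using R_sat norm_u by auto

lemma measurable_link_outage [measurable]: "link_outage j \<in> borel_measurable borel"
proof (cases "j = 0")
  case True
  have "continuous_on UNIV (\<lambda>t. F (\<gamma> * (r_LU R_earth R_sat t)\<^sup>2 / \<xi> 0))"
    by (rule continuous_on_compose2[OF F_cont])
       (use \<gamma> \<xi>[of 0] in \<open>auto simp: r_LU_def intro!: continuous_intros\<close>)
  then show ?thesis
    unfolding link_outage_def True P_Cond_LU_def by (simp add: borel_measurable_continuous_onI)
next
  case False
  then show ?thesis unfolding link_outage_def using borel_measurable_P_out_FU[OF F_cont \<gamma> \<xi> \<theta>_cap(1)] by simp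
qed

text \<open>A link outside \<open>J\<close> imposes no constraint. The index range can thus stay
  {0..N_F} throughout while \<open>J\<close> selects the links whose outage is asked for.\<close>

definition outage_points :: "nat set \<Rightarrow> nat \<Rightarrow> real \<Rightarrow> (real^3) set" where
  "outage_points J j w = {x. j \<in> J \<longrightarrow> snr (\<xi> j) w (dist u x) < \<gamma>}"

lemma measurable_outage_points [measurable]:
  assumes [measurable]: "f \<in> borel_measurable N" "g \<in> borel_measurable N"
  shows "Measurable.pred N (\<lambda>z. g z \<in> outage_points J j (f z))"
  unfolding outage_points_def snr_def by simp

lemma sets_outage_points [measurable]: "outage_points J j w \<in> sets borel"
  using measurable_outage_points[of "\<lambda>_. w" borel "\<lambda>x. x" J j] by (simp add: pred_def)

lemma emeasure_outage_fading:
  assumes j: "j \<in> {0..N_F}" and x: "norm x = R_sat"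
  shows "emeasure (\<mu> j) {w. x \<in> outage_points J j w} =
    (if j \<in> J then ennreal (F (\<gamma> * (dist u x)\<^sup>2 / \<xi> j)) else 1)"
proof (cases "j \<in> J")
  case True
  then show ?thesis using emeasure_fading[OF j dist_pos[OF x] \<xi>] by (simp add: outage_points_def)
next
  case False
  interpret D: real_distribution "\<mu> j" using j by (rule real_distribution_\<mu>)
  show ?thesis using False D.emeasure_space_1 by (simp add: outage_points_def)
qed

text \<open>By Tonelli, averaging the cap mass over the fading is the same as averaging the fading
  probability over the cap, and the latter is the link outage formula.\<close>

lemma nn_integral_cap_fading:
  assumes j: "j \<in> {1..N_F}" and c: "norm c = R_sat"
  shows "(\<integral>\<^sup>+w. emeasure (uniform_cap R_sat c \<theta>_cap) (outage_points J j w) \<partial>\<mu> j) =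
    (if j \<in> J then ennreal (link_outage j (central_angle c u)) else 1)"
proof -
  let ?U = "uniform_cap R_sat c \<theta>_cap"
  have j': "j \<in> {0..N_F}" using j by auto
  interpret D: real_distribution "\<mu> j" using j' by (rule real_distribution_\<mu>)
  interpret U: prob_space ?U using c R_sat_pos \<theta>_cap by (intro prob_space_uniform_cap) auto
  interpret pair_sigma_finite "\<mu> j" ?U ..
  have "(\<integral>\<^sup>+w. emeasure ?U (outage_points J j w) \<partial>\<mu> j) = (\<integral>\<^sup>+w. \<integral>\<^sup>+x. indicator {x. x \<in> outage_points J j w} x \<partial>?U \<partial>\<mu> j)"
    by (intro nn_integral_cong) (simp add: sets_outage_points)
  also have "\<dots> = (\<integral>\<^sup>+x. \<integral>\<^sup>+w. indicator {x. x \<in> outage_points J j w} x \<partial>\<mu> j \<partial>?U)"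
    by (rule Fubini'[symmetric]) (simp add: case_prod_beta', measurable)
  also have "\<dots> = (\<integral>\<^sup>+x. (if j \<in> J then ennreal (F (\<gamma> * (dist u x)\<^sup>2 / \<xi> j)) else 1) \<partial>?U)"
  proof (rule nn_integral_cong_AE)
    \<comment> \<open>The fading formula needs a positive distance to the user, which points of the
      satellite sphere have.\<close>
    have "AE x in ?U. norm x = R_sat"
      unfolding uniform_cap_def using AE_uniform_sphere_norm[of R_sat] R_sat_pos
      by (intro AE_uniform_measureI) (auto simp: sets_spherical_cap)
    then show "AE x in ?U. (\<integral>\<^sup>+w. indicator {x. x \<in> outage_points J j w} x \<partial>\<mu> j) =
        (if j \<in> J then ennreal (F (\<gamma> * (dist u x)\<^sup>2 / \<xi> j)) else 1)"
    proof eventually_elim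
      case (elim x)
      have "{w. x \<in> outage_points J j w} \<in> sets borel"
        using measurable_outage_points[of "\<lambda>w. w" borel "\<lambda>_. x" J j] by (simp add: pred_def)
      then have "(\<integral>\<^sup>+w. indicator {x. x \<in> outage_points J j w} x \<partial>\<mu> j) = emeasure (\<mu> j) {w. x \<in> outage_points J j w}"
        using nn_integral_indicator[of "{w. x \<in> outage_points J j w}" "\<mu> j"] by (simp add: indicator_def)
      then show ?case using emeasure_outage_fading[OF j' elim] by simp
    qed
  qed
  also have "\<dots> = (if j \<in> J then ennreal (link_outage j (central_angle c u)) else 1)"
    using P_out_FU_eq_nn_integral(1)[OF F_cont F_bounds \<gamma> \<xi> c R_sat_pos norm_u R_earth \<theta>_cap] j U.emeasure_space_1
    by (simp add: link_outage_def)
  finally show ?thesis .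
qed

lemma link_outage_nonneg:
  assumes "norm c = R_sat"
  shows "0 \<le> link_outage j (central_angle c u)"
proof (cases "j = 0")
  case True
  then show ?thesis using F_bounds(1) \<gamma> \<xi>[of 0] by (simp add: link_outage_def P_Cond_LU_def)
next
  case False
  then show ?thesis
    using P_out_FU_eq_nn_integral(2)[OF F_cont F_bounds \<gamma> \<xi> assms R_sat_pos norm_u R_earth \<theta>_cap] by (simp add: link_outage_def)
qed


section \<open>Joint outage of an arbitrary set of links\<close>

abbreviation "serving j \<omega> \<equiv> (if j = 0 then lead \<omega> else X j \<omega>)"

text \<open>The contact angle and the leader constraint are determined by the leader positions, so
  both go into one set of the conditioning variable; conditional independence is then applied to the
  follower sets.\<close>

lemma emeasure_positions:
  assumes B[measurable]: "B \<in> sets borel" and C: "\<And>j. j \<in> {0..N_F} \<Longrightarrow> C j \<in> sets borel"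
    and K: "\<And>j. j \<in> {1..N_F} \<Longrightarrow> (\<lambda>\<omega>. emeasure (K \<omega>) (C j)) \<in> borel_measurable M"
  shows "emeasure M {\<omega> \<in> space M. \<theta> \<omega> \<in> B \<and> (\<forall>j\<in>{0..N_F}. serving j \<omega> \<in> C j)} =
    (\<integral>\<^sup>+\<omega>. indicator B (\<theta> \<omega>) * (\<Prod>j\<in>{0..N_F}. if j = 0 then indicator (C 0) (lead \<omega>) else emeasure (K \<omega>) (C j)) \<partial>M)"
proof -
  let ?B = "{p \<in> space N_P. central_angle (nearest p) u \<in> B \<and> nearest p \<in> C 0}"
  have [measurable]: "C 0 \<in> sets borel" using C by simp
  have B': "?B \<in> sets N_P" by measurable
  have mK: "(\<lambda>\<omega>. measure (K \<omega>) (C j)) \<in> borel_measurable M" if "j \<in> {1..N_F}" for j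
    using K[OF that] unfolding measure_def by measurable
  have split: "{0..N_F} = insert 0 {1..N_F}" by auto
  have "pos \<omega> \<in> space N_P" if "\<omega> \<in> space M" for \<omega> using measurable_space[OF measurable_pos that] .
  then have ev: "{\<omega> \<in> space M. \<theta> \<omega> \<in> B \<and> (\<forall>j\<in>{0..N_F}. serving j \<omega> \<in> C j)} =
      {\<omega> \<in> space M. pos \<omega> \<in> ?B \<and> (\<forall>i\<in>{1..N_F}. X i \<omega> \<in> C i)}"
    unfolding split by (auto simp: contact_angle_def lead_eq_nearest)
  let ?f = "\<lambda>\<omega>. indicat_real ?B (pos \<omega>) * (\<Prod>i\<in>{1..N_F}. measure (K \<omega>) (C i))"
  \<comment> \<open>\<open>prob_space_uniform_cap\<close> asks for a nonzero centre, which the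
    associated leader is almost surely.\<close>
  have prob_K: "AE \<omega> in M. prob_space (K \<omega>)"
    using AE_norm_lead by eventually_elim (use R_sat_pos \<theta>_cap in \<open>auto intro!: prob_space_uniform_cap\<close>)
  have m: "?f \<in> borel_measurable M"
    using mK measurable_compose[OF measurable_pos borel_measurable_indicator[OF B']]
    by (intro borel_measurable_times borel_measurable_prod) auto
  have int: "integrable M ?f"
  proof (rule integrable_const_bound[of _ 1])
    show "AE \<omega> in M. norm (?f \<omega>) \<le> 1"
      using prob_K
    proof eventually_elim
      case (elim \<omega>)
      interpret KK: prob_space "K \<omega>" by (rule elim)
      have "(\<Prod>i\<in>{1..N_F}. KK.prob (C i)) \<le> 1" "0 \<le> (\<Prod>i\<in>{1..N_F}. KK.prob (C i))"
        by (auto intro!: prod_le_1 prod_nonneg)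
      then show ?case by (simp add: indicator_def)
    qed
  qed (rule m)
  have "emeasure M {\<omega> \<in> space M. \<theta> \<omega> \<in> B \<and> (\<forall>j\<in>{0..N_F}. serving j \<omega> \<in> C j)} = ennreal (\<integral>\<omega>. ?f \<omega> \<partial>M)"
    unfolding ev emeasure_eq_measure
    using C mK by (subst prob_cond_iid_given[OF followers measurable_pos _ _ B']) (auto intro!: borel_measurable_prod)
  also have "\<dots> = (\<integral>\<^sup>+\<omega>. ennreal (?f \<omega>) \<partial>M)"
    using int by (intro nn_integral_eq_integral[symmetric]) (auto intro!: AE_I2 mult_nonneg_nonneg prod_nonneg)
  also have "\<dots> = (\<integral>\<^sup>+\<omega>. indicator B (\<theta> \<omega>) * (\<Prod>j\<in>{0..N_F}. if j = 0 then indicator (C 0) (lead \<omega>) else emeasure (K \<omega>) (C j)) \<partial>M)"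
  proof (rule nn_integral_cong_AE)
    show "AE \<omega> in M. ennreal (?f \<omega>) = indicator B (\<theta> \<omega>) *
        (\<Prod>j\<in>{0..N_F}. if j = 0 then indicator (C 0) (lead \<omega>) else emeasure (K \<omega>) (C j))"
      using prob_K AE_space
    proof eventually_elim
      case (elim \<omega>)
      interpret KK: prob_space "K \<omega>" by (rule elim)
      have "indicat_real ?B (pos \<omega>) = indicator B (\<theta> \<omega>) * indicator (C 0) (lead \<omega>)"
        using measurable_space[OF measurable_pos elim(2)] by (simp add: indicator_def contact_angle_def lead_eq_nearest)
      moreover have "ennreal (\<Prod>i\<in>{1..N_F}. KK.prob (C i)) = (\<Prod>i\<in>{1..N_F}. emeasure (K \<omega>) (C i))"
        by (simp add: KK.emeasure_eq_measure prod_ennreal)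
      moreover have "(\<Prod>j\<in>{1..N_F}. if j = 0 then indicator (C 0) (lead \<omega>) else emeasure (K \<omega>) (C j)) =
          (\<Prod>i\<in>{1..N_F}. emeasure (K \<omega>) (C i))" by (rule prod.cong) auto
      ultimately show ?case
        unfolding split by (simp add: ennreal_mult prod_nonneg ennreal_indicator mult.assoc)
    qed
  qed
  finally show ?thesis .
qed

text \<open>For a fixed outcome of the positions the integrand is a product of functions of single
  fading powers, and these have a product law, so the average over the fading factorises. Almost
  surely each factor depends on the outcome only through the contact angle.\<close>

lemma emeasure_outage:
  assumes J: "J \<subseteq> {0..N_F}" and B[measurable]: "B \<in> sets borel"
  shows "emeasure M {\<omega> \<in> space M. \<theta> \<omega> \<in> B \<and> (\<forall>j\<in>J. snr (\<xi> j) (W j \<omega>) (dist u (serving j \<omega>)) < \<gamma>)} =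
    (\<integral>\<^sup>+\<omega>. indicator B (\<theta> \<omega>) * (\<Prod>j\<in>J. ennreal (link_outage j (\<theta> \<omega>))) \<partial>M)"
proof -
  let ?NW = "\<Pi>\<^sub>M i\<in>{0..N_F}. (borel :: real measure)"
  let ?NX = "\<Pi>\<^sub>M i\<in>{1..N_F}. (borel :: (real^3) measure)"
  let ?WW = "\<lambda>\<omega>. \<lambda>i\<in>{0..N_F}. W i \<omega>"
  let ?PX = "\<lambda>\<omega>. (pos \<omega>, \<lambda>i\<in>{1..N_F}. X i \<omega>)"
  let ?S = "outage_points J"
  have WW[measurable]: "?WW \<in> M \<rightarrow>\<^sub>M ?NW" and PX[measurable]: "?PX \<in> M \<rightarrow>\<^sub>M (N_P \<Otimes>\<^sub>M ?NX)"
    using fading_indep_positions by (auto simp: indep_rvs_def)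
  interpret DW: prob_space "distr M ?NW ?WW" by (rule prob_space_distr) fact
  interpret DP: prob_space "distr M (N_P \<Otimes>\<^sub>M ?NX) ?PX" by (rule prob_space_distr) fact
  define pt where "pt = (\<lambda>(j::nat) (p, x). if j = 0 then nearest p else x j :: real^3)"
  have pt[measurable]: "pt j \<in> (N_P \<Otimes>\<^sub>M ?NX) \<rightarrow>\<^sub>M borel" if "j \<in> {0..N_F}" for j
  proof (cases "j = 0")
    case True
    then show ?thesis
      unfolding pt_def case_prod_beta using measurable_compose[OF measurable_fst measurable_nearest] by simp
  next
    case False
    then have "j \<in> {1..N_F}" using that by simp
    from measurable_compose[OF measurable_snd measurable_component_singleton[OF this]]
    show ?thesis unfolding pt_def case_prod_beta using False by simp
  qed
  have pt_PX: "pt j (?PX \<omega>) = serving j \<omega>" if "j \<in> {0..N_F}" for j \<omega>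
    using that by (simp add: pt_def lead_eq_nearest)
  \<comment> \<open>The event as a set of fading vectors paired with positions; its slice at a
    fading vector constrains the positions alone.\<close>
  define Z where "Z = {z \<in> space (?NW \<Otimes>\<^sub>M (N_P \<Otimes>\<^sub>M ?NX)).
    central_angle (pt 0 (snd z)) u \<in> B \<and> (\<forall>j\<in>{0..N_F}. pt j (snd z) \<in> ?S j (fst z j))}"
  have Z: "Z \<in> sets (?NW \<Otimes>\<^sub>M (N_P \<Otimes>\<^sub>M ?NX))"
    unfolding Z_def
  proof (intro sets.sets_Collect_conj sets.sets_Collect_finite_All)
    have [measurable]: "pt 0 \<in> (N_P \<Otimes>\<^sub>M ?NX) \<rightarrow>\<^sub>M borel" by (rule pt) simp
    show "{z \<in> space (?NW \<Otimes>\<^sub>M (N_P \<Otimes>\<^sub>M ?NX)). central_angle (pt 0 (snd z)) u \<in> B} \<in> sets (?NW \<Otimes>\<^sub>M (N_P \<Otimes>\<^sub>M ?NX))"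
      by measurable
    fix j assume j: "j \<in> {0..N_F}"
    show "{z \<in> space (?NW \<Otimes>\<^sub>M (N_P \<Otimes>\<^sub>M ?NX)). pt j (snd z) \<in> ?S j (fst z j)} \<in> sets (?NW \<Otimes>\<^sub>M (N_P \<Otimes>\<^sub>M ?NX))"
      using measurable_outage_points[OF measurable_compose[OF measurable_fst measurable_component_singleton[OF j]]
          measurable_compose[OF measurable_snd pt[OF j]], of J j]
      by (simp add: pred_def)
  qed simp
  have mK: "(\<lambda>z. emeasure (K (fst z)) (?S j (snd z))) \<in> borel_measurable (M \<Otimes>\<^sub>M borel)" for j
    using measurable_emeasure_uniform_cap[of "\<lambda>z. lead (fst z)" "M \<Otimes>\<^sub>M borel" "\<lambda>z x. x \<in> ?S j (snd z)" R_sat \<theta>_cap]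
    by (simp add: case_prod_beta')
  \<comment> \<open>The contribution of link \<open>j\<close> at a fixed fading value: the leader
    position is known given \<omega>, a follower is still averaged over its cap.\<close>
  define H where "H = (\<lambda>j \<omega> w. if j = 0 then indicator (?S 0 w) (lead \<omega>) else emeasure (K \<omega>) (?S j w))"
  have H: "(\<lambda>z. H j (fst z) (snd z)) \<in> borel_measurable (M \<Otimes>\<^sub>M borel)" for j
  proof (cases "j = 0")
    case True
    have "(\<lambda>z. indicator {z. lead (fst z) \<in> ?S 0 (snd z)} z :: ennreal) \<in> borel_measurable (M \<Otimes>\<^sub>M borel)"
      by measurable
    then show ?thesis by (simp add: H_def True indicator_def)
  next
    case False
    then show ?thesis using mK by (simp add: H_def)
  qed
  have slice: "emeasure (distr M (N_P \<Otimes>\<^sub>M ?NX) ?PX) (Pair w -` Z) =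
      (\<integral>\<^sup>+\<omega>. indicator B (\<theta> \<omega>) * (\<Prod>j\<in>{0..N_F}. H j \<omega> (w j)) \<partial>M)" if w: "w \<in> space ?NW" for w
  proof -
    have "Pair w -` Z \<in> sets (N_P \<Otimes>\<^sub>M ?NX)" using Z by (rule sets_Pair1)
    moreover have "?PX -` (Pair w -` Z) \<inter> space M =
        {\<omega> \<in> space M. \<theta> \<omega> \<in> B \<and> (\<forall>j\<in>{0..N_F}. serving j \<omega> \<in> ?S j (w j))}"
      using measurable_space[OF PX] w pt_PX
      by (auto simp: Z_def space_pair_measure contact_angle_def)
    ultimately have "emeasure (distr M (N_P \<Otimes>\<^sub>M ?NX) ?PX) (Pair w -` Z) =
        emeasure M {\<omega> \<in> space M. \<theta> \<omega> \<in> B \<and> (\<forall>j\<in>{0..N_F}. serving j \<omega> \<in> ?S j (w j))}"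
      by (simp only: emeasure_distr[OF PX])
    also have "\<dots> = (\<integral>\<^sup>+\<omega>. indicator B (\<theta> \<omega>) * (\<Prod>j\<in>{0..N_F}. H j \<omega> (w j)) \<partial>M)"
      unfolding H_def
    proof (subst emeasure_positions[OF B])
      fix j assume "j \<in> {1..N_F}"
      show "(\<lambda>\<omega>. emeasure (K \<omega>) (?S j (w j))) \<in> borel_measurable M"
        using measurable_compose[OF _ mK[of j], of "\<lambda>\<omega>. (\<omega>, w j)" M] by simp
    qed (auto simp: sets_outage_points intro!: nn_integral_cong arg_cong2[where f = "(*)"] prod.cong)
    finally show ?thesis .
  qed
  have distr_WW: "distr M ?NW ?WW = (\<Pi>\<^sub>M j\<in>{0..N_F}. \<mu> j)"
    using fading_indep indep_vars_iff_distr_eq_PiM'[of "{0..N_F}" W "\<lambda>_. borel"] measurable_W by auto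
  \<comment> \<open>\<open>product_prob_space\<close> asks for a probability measure at every index,
    so the family is continued by \<open>\<mu> 0\<close> outside the range.\<close>
  define \<mu>' where "\<mu>' j = (if j \<in> {0..N_F} then \<mu> j else \<mu> 0)" for j
  have prob_\<mu>': "prob_space (\<mu>' j)" for j
    using measurable_W by (auto simp: \<mu>'_def intro: prob_space_distr)
  interpret PS: product_prob_space \<mu>' "{0..N_F}"
    by (intro product_prob_spaceI prob_\<mu>')
  have PiM_\<mu>': "distr M ?NW ?WW = (\<Pi>\<^sub>M j\<in>{0..N_F}. \<mu>' j)"
    unfolding distr_WW by (rule PiM_cong) (auto simp: \<mu>'_def)
  interpret FB: pair_sigma_finite "distr M ?NW ?WW" M ..
  have "emeasure M {\<omega> \<in> space M. \<theta> \<omega> \<in> B \<and> (\<forall>j\<in>J. snr (\<xi> j) (W j \<omega>) (dist u (serving j \<omega>)) < \<gamma>)} =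
      emeasure M ((\<lambda>\<omega>. (?WW \<omega>, ?PX \<omega>)) -` Z \<inter> space M)"
  proof (rule arg_cong[where f = "emeasure M"])
    have "(?WW \<omega>, ?PX \<omega>) \<in> Z \<longleftrightarrow> \<theta> \<omega> \<in> B \<and> (\<forall>j\<in>J. snr (\<xi> j) (W j \<omega>) (dist u (serving j \<omega>)) < \<gamma>)"
      if "\<omega> \<in> space M" for \<omega>
      using measurable_space[OF PX that] measurable_space[OF WW that] J
      unfolding Z_def mem_Collect_eq fst_conv snd_conv
      by (auto simp: space_pair_measure pt_PX outage_points_def contact_angle_def simp del: One_nat_def split: if_splits)
    then show "{\<omega> \<in> space M. \<theta> \<omega> \<in> B \<and> (\<forall>j\<in>J. snr (\<xi> j) (W j \<omega>) (dist u (serving j \<omega>)) < \<gamma>)} =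
      (\<lambda>\<omega>. (?WW \<omega>, ?PX \<omega>)) -` Z \<inter> space M" by blast
  qed
  also have "\<dots> = emeasure (distr M (?NW \<Otimes>\<^sub>M (N_P \<Otimes>\<^sub>M ?NX)) (\<lambda>\<omega>. (?WW \<omega>, ?PX \<omega>))) Z"
    by (rule emeasure_distr[OF measurable_Pair[OF WW PX] Z, symmetric])
  also have "\<dots> = (\<integral>\<^sup>+w. emeasure (distr M (N_P \<Otimes>\<^sub>M ?NX) ?PX) (Pair w -` Z) \<partial>distr M ?NW ?WW)"
  proof -
    have "sets (distr M ?NW ?WW \<Otimes>\<^sub>M distr M (N_P \<Otimes>\<^sub>M ?NX) ?PX) = sets (?NW \<Otimes>\<^sub>M (N_P \<Otimes>\<^sub>M ?NX))"
      by (rule sets_pair_measure_cong) simp_all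
    then show ?thesis
      unfolding distr_indep_rvs[OF fading_indep_positions]
      by (intro DP.emeasure_pair_measure_alt) (use Z in simp)
  qed
  also have "\<dots> = (\<integral>\<^sup>+w. \<integral>\<^sup>+\<omega>. indicator B (\<theta> \<omega>) * (\<Prod>j\<in>{0..N_F}. H j \<omega> (w j)) \<partial>M \<partial>distr M ?NW ?WW)"
    by (intro nn_integral_cong slice) simp
  also have "\<dots> = (\<integral>\<^sup>+\<omega>. \<integral>\<^sup>+w. indicator B (\<theta> \<omega>) * (\<Prod>j\<in>{0..N_F}. H j \<omega> (w j)) \<partial>distr M ?NW ?WW \<partial>M)"
  proof (rule FB.Fubini'[symmetric])
    have "(\<lambda>z. H j (snd z) (fst z j)) \<in> borel_measurable (?NW \<Otimes>\<^sub>M M)" if j: "j \<in> {0..N_F}" for j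
    proof -
      have "(\<lambda>z. (snd z, fst z j)) \<in> (?NW \<Otimes>\<^sub>M M) \<rightarrow>\<^sub>M (M \<Otimes>\<^sub>M borel)"
        by (rule measurable_Pair[OF measurable_snd measurable_compose[OF measurable_fst measurable_component_singleton[OF j]]])
      from measurable_compose[OF this H[of j]] show ?thesis by (simp only: fst_conv snd_conv)
    qed
    moreover have "(\<lambda>z. indicator B (\<theta> (snd z)) :: ennreal) \<in> borel_measurable (?NW \<Otimes>\<^sub>M M)" by measurable
    ultimately have "(\<lambda>z. indicator B (\<theta> (snd z)) * (\<Prod>j\<in>{0..N_F}. H j (snd z) (fst z j))) \<in> borel_measurable (?NW \<Otimes>\<^sub>M M)"
      by (intro borel_measurable_times_ennreal borel_measurable_prod_ennreal) auto
    moreover have "sets (distr M ?NW ?WW \<Otimes>\<^sub>M M) = sets (?NW \<Otimes>\<^sub>M M)"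
      by (rule sets_pair_measure_cong) simp_all
    ultimately show "(\<lambda>(w, \<omega>). indicator B (\<theta> \<omega>) * (\<Prod>j\<in>{0..N_F}. H j \<omega> (w j))) \<in> borel_measurable (distr M ?NW ?WW \<Otimes>\<^sub>M M)"
      by (simp add: case_prod_beta' cong: measurable_cong_sets)
  qed
  also have "\<dots> = (\<integral>\<^sup>+\<omega>. indicator B (\<theta> \<omega>) * (\<Prod>j\<in>J. ennreal (link_outage j (\<theta> \<omega>))) \<partial>M)"
  proof (rule nn_integral_cong_AE)
    show "AE \<omega> in M. (\<integral>\<^sup>+w. indicator B (\<theta> \<omega>) * (\<Prod>j\<in>{0..N_F}. H j \<omega> (w j)) \<partial>distr M ?NW ?WW) =
        indicator B (\<theta> \<omega>) * (\<Prod>j\<in>J. ennreal (link_outage j (\<theta> \<omega>)))"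
      using AE_norm_lead AE_space
    proof eventually_elim
      case (elim \<omega>)
      have Hj: "H j \<omega> \<in> borel_measurable (\<mu>' j)" for j
        using measurable_compose[OF _ H[of j], of "\<lambda>w. (\<omega>, w)" borel] elim(2) by (simp add: \<mu>'_def)
      have val: "(\<integral>\<^sup>+w. H j \<omega> w \<partial>\<mu>' j) = (if j \<in> J then ennreal (link_outage j (\<theta> \<omega>)) else 1)" if j: "j \<in> {0..N_F}" for j
      proof (cases "j = 0")
        case True
        have "{w. lead \<omega> \<in> ?S 0 w} \<in> sets borel"
          using measurable_outage_points[of "\<lambda>w. w" borel "\<lambda>_. lead \<omega>" J 0] by (simp add: pred_def)
        then have "(\<integral>\<^sup>+w. H 0 \<omega> w \<partial>\<mu> 0) = emeasure (\<mu> 0) {w. lead \<omega> \<in> ?S 0 w}"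
          using nn_integral_indicator[of "{w. lead \<omega> \<in> ?S 0 w}" "\<mu> 0"] by (simp add: indicator_def H_def)
        then show ?thesis
          using emeasure_outage_fading[OF j elim(1), of J] True R_sat_pos norm_u R_earth
            r_LU_eq_dist[of "lead \<omega>" R_sat u R_earth] elim(1)
          by (simp add: \<mu>'_def link_outage_def P_Cond_LU_def contact_angle_def)
      next
        case False
        then show ?thesis
          using nn_integral_cap_fading[of j "lead \<omega>" J] j elim(1)
          by (simp add: \<mu>'_def H_def contact_angle_def)
      qed
      have "(\<integral>\<^sup>+w. indicator B (\<theta> \<omega>) * (\<Prod>j\<in>{0..N_F}. H j \<omega> (w j)) \<partial>distr M ?NW ?WW) =
          indicator B (\<theta> \<omega>) * (\<integral>\<^sup>+w. (\<Prod>j\<in>{0..N_F}. H j \<omega> (w j)) \<partial>(\<Pi>\<^sub>M j\<in>{0..N_F}. \<mu>' j))"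
        unfolding PiM_\<mu>' using Hj
        by (intro nn_integral_cmult borel_measurable_prod_ennreal) (auto intro: measurable_compose[OF measurable_component_singleton])
      also have "(\<integral>\<^sup>+w. (\<Prod>j\<in>{0..N_F}. H j \<omega> (w j)) \<partial>(\<Pi>\<^sub>M j\<in>{0..N_F}. \<mu>' j)) = (\<Prod>j\<in>{0..N_F}. \<integral>\<^sup>+w. H j \<omega> w \<partial>\<mu>' j)"
        using Hj by (intro PS.product_nn_integral_prod) auto
      also have "\<dots> = (\<Prod>j\<in>{0..N_F}. if j \<in> J then ennreal (link_outage j (\<theta> \<omega>)) else 1)"
        using val by (intro prod.cong) auto
      \<comment> \<open>Links outside \<open>J\<close> contribute the factor 1.\<close>
      also have "\<dots> = (\<Prod>j\<in>J. ennreal (link_outage j (\<theta> \<omega>)))"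
        using J by (intro prod.mono_neutral_cong_right) auto
      finally show ?case .
    qed
  qed
  finally show ?thesis .
qed

end

subsection \<open>The law of the contact angle\<close>

lemma central_angle_commute: "central_angle x y = central_angle y x"
  by (simp add: central_angle_def inner_commute mult.commute)

text \<open>Needed to carry the nonnegativity of \<open>link_outage\<close> from angles seen at
  actual centres to every angle in [0, pi].\<close>

lemma ex_central_angle:
  fixes u :: "real^3"
  assumes "u \<noteq> 0" "0 < R" "0 \<le> t" "t \<le> pi"
  obtains c where "norm c = R" "central_angle c u = t"
proof -
  obtain Q :: "real^3 \<Rightarrow> real^3" where Q: "orthogonal_transformation Q" "Q (axis 3 1) = u /\<^sub>R norm u"
    using ex_orthogonal_frame[OF assms(1) assms(1)] by metis
  have "central_angle u (R *\<^sub>R Q (polar_direction 0 t)) = t"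
    using central_angle_frame[OF Q assms] .
  moreover have "norm (R *\<^sub>R Q (polar_direction 0 t)) = R"
    using orthogonal_transformation_norm[OF Q(1)] assms(2) by simp
  ultimately show ?thesis using that by (metis central_angle_commute)
qed

context satellite_cluster
begin

lemma u_nonzero: "u \<noteq> 0" using norm_u R_earth by auto

lemma contact_angle_bounds: "0 \<le> \<theta> \<omega>" "\<theta> \<omega> \<le> pi"
  by (simp_all add: contact_angle_def central_angle_bounds)

text \<open>Among points of equal norm, both a smaller distance to \<open>u\<close> and a smaller
  central angle mean a larger inner product with \<open>u\<close>; so the nearest leader also has
  the smallest angle.\<close>

lemma contact_angle_greater_iff:
  assumes n: "\<forall>j\<in>{1..N_L}. norm (L j \<omega>) = R_sat"
  shows "t < \<theta> \<omega> \<longleftrightarrow> (\<forall>j\<in>{1..N_L}. t < central_angle (L j \<omega>) u)"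
proof -
  define k where "k = arg_min_on (\<lambda>j. dist (L j \<omega>) u) {1..N_L}"
  have k: "k \<in> {1..N_L}" unfolding k_def by (rule arg_min_if_finite(1)) (use N_L in auto)
  have "central_angle (L k \<omega>) u \<le> central_angle (L j \<omega>) u" if j: "j \<in> {1..N_L}" for j
  proof -
    have "dist (L k \<omega>) u \<le> dist (L j \<omega>) u"
      unfolding k_def by (rule arg_min_least) (use j in auto)
    then have le: "(norm (L k \<omega> - u))\<^sup>2 \<le> (norm (L j \<omega> - u))\<^sup>2" unfolding dist_norm by (intro power_mono) auto
    have "norm (L k \<omega>) = R_sat" "norm (L j \<omega>) = R_sat" using n j k by blast+
    then have "L j \<omega> \<bullet> u \<le> L k \<omega> \<bullet> u"
      unfolding dot_norm_neg[of "L k \<omega>" u] dot_norm_neg[of "L j \<omega>" u] using le by simp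
    then have "cos (central_angle (L j \<omega>) u) \<le> cos (central_angle (L k \<omega>) u)"
      using n j k R_sat_pos R_earth norm_u unfolding cos_central_angle by (simp add: divide_right_mono)
    then show ?thesis by (simp add: cos_mono_le_eq central_angle_bounds)
  qed
  moreover have "\<theta> \<omega> = central_angle (L k \<omega>) u"
    by (simp add: contact_angle_def associated_leader_def k_def)
  ultimately show ?thesis using k by fastforce
qed

lemma emeasure_sphere_angle_greater:
  assumes t: "0 \<le> t" "t \<le> pi"
  shows "emeasure (uniform_sphere R_sat) {x. t < central_angle x u} = ennreal ((1 + cos t) / 2)"
proof -
  interpret U: prob_space "uniform_sphere R_sat" by (rule prob_space_uniform_sphere)
  have "{x \<in> space borel. t < central_angle x u} \<in> sets borel" by measurable
  then have A: "{x. t < central_angle x u} \<in> sets borel" by simp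
  have "emeasure (uniform_sphere R_sat) {x. t < central_angle x u} = emeasure (uniform_sphere R_sat) (space (uniform_sphere R_sat) - spherical_cap R_sat u t)"
  proof (rule emeasure_eq_AE)
    show "AE x in uniform_sphere R_sat. (x \<in> {x. t < central_angle x u}) = (x \<in> space (uniform_sphere R_sat) - spherical_cap R_sat u t)"
      using AE_uniform_sphere_norm[of R_sat] R_sat_pos
      by (auto simp: spherical_cap_def central_angle_commute not_le)
  qed (use A in \<open>auto simp: sets_spherical_cap\<close>)
  also have "\<dots> = ennreal (1 - U.prob (spherical_cap R_sat u t))"
    unfolding U.emeasure_eq_measure by (subst U.prob_compl) (auto simp: sets_spherical_cap)
  also have "U.prob (spherical_cap R_sat u t) = (1 - cos t) / 2"
    using emeasure_spherical_cap[OF u_nonzero R_sat_pos t] by (simp add: measure_def)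
  finally show ?thesis by (simp add: field_simps)
qed

lemma prob_contact_angle_greater:
  assumes t: "0 \<le> t" "t \<le> pi"
  shows "prob {\<omega> \<in> space M. t < \<theta> \<omega>} = ((1 + cos t) / 2) ^ N_L"
proof -
  let ?A = "{x. t < central_angle x u}"
  have "{x \<in> space borel. t < central_angle x u} \<in> sets borel" by measurable
  then have A: "?A \<in> sets borel" by simp
  have L: "L j -` ?A \<inter> space M \<in> events" if "j \<in> {1..N_L}" for j
    using measurable_L[OF that] A by (rule measurable_sets)
  have p: "prob (L j -` ?A \<inter> space M) = (1 + cos t) / 2" if j: "j \<in> {1..N_L}" for j
  proof -
    have "ennreal (prob (L j -` ?A \<inter> space M)) = ennreal ((1 + cos t) / 2)"
      using emeasure_sphere_angle_greater[OF t] unfolding leaders_uniform[OF j, symmetric]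
      by (simp add: emeasure_distr[OF measurable_L[OF j] A] emeasure_eq_measure)
    then show ?thesis using cos_ge_minus_one[of t] by simp
  qed
  have "prob {\<omega> \<in> space M. t < \<theta> \<omega>} = prob (\<Inter>j\<in>{1..N_L}. L j -` ?A \<inter> space M)"
  proof (rule measure_eq_AE)
    show "AE \<omega> in M. (\<omega> \<in> {\<omega> \<in> space M. t < \<theta> \<omega>}) = (\<omega> \<in> (\<Inter>j\<in>{1..N_L}. L j -` ?A \<inter> space M))"
      using AE_norm_L AE_space
    proof eventually_elim
      case (elim \<omega>)
      then show ?case using contact_angle_greater_iff[OF elim(1), of t] by auto
    qed
    show "{\<omega> \<in> space M. t < \<theta> \<omega>} \<in> events" by measurable
    show "(\<Inter>j\<in>{1..N_L}. L j -` ?A \<inter> space M) \<in> events"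
      using L N_L by (intro sets.finite_INT) auto
  qed
  also have "\<dots> = (\<Prod>j\<in>{1..N_L}. prob (L j -` ?A \<inter> space M))"
    using A N_L by (intro indep_varsD[OF leaders_indep]) auto
  also have "\<dots> = (\<Prod>j\<in>{1..N_L}. (1 + cos t) / 2)" by (rule prod.cong[OF refl p])
  also have "\<dots> = ((1 + cos t) / 2) ^ N_L" by simp
  finally show ?thesis .
qed

lemma contact_angle_pdf_nonneg:
  assumes "0 \<le> t" "t \<le> pi"
  shows "0 \<le> contact_angle_pdf N_L t"
proof -
  have "1 + - 1 \<le> 1 + cos t" by (intro add_left_mono cos_ge_minus_one)
  then have "0 \<le> (1 + cos t) / 2" by simp
  then show ?thesis unfolding contact_angle_pdf_def using sin_ge_zero[OF assms] by simp
qed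

lemma measurable_contact_angle_pdf [measurable]: "contact_angle_pdf N_L \<in> borel_measurable borel"
  unfolding contact_angle_pdf_def by measurable

lemma nn_integral_contact_angle_pdf:
  assumes "0 \<le> a" "a \<le> pi"
  shows "(\<integral>\<^sup>+t. ennreal (contact_angle_pdf N_L t) * indicator {0..a} t \<partial>lborel) = ennreal (1 - ((1 + cos a) / 2) ^ N_L)"
proof -
  \<comment> \<open>The antiderivative is minus the tail probability from
    \<open>prob_contact_angle_greater\<close>.\<close>
  have "(\<integral>\<^sup>+t. ennreal (contact_angle_pdf N_L t) * indicator {0..a} t \<partial>lborel) =
      ennreal (- (((1 + cos a) / 2) ^ N_L) - (- (((1 + cos 0) / 2) ^ N_L)))"
  proof (rule nn_integral_FTC_Icc)
    fix t assume "t \<in> {0..a}"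
    show "((\<lambda>t. - (((1 + cos t) / 2) ^ N_L)) has_real_derivative contact_angle_pdf N_L t) (at t)"
      unfolding contact_angle_pdf_def
      by (auto intro!: derivative_eq_intros)
  next
    fix t assume "t \<in> {0..a}"
    then show "0 \<le> contact_angle_pdf N_L t" using assms by (intro contact_angle_pdf_nonneg) auto
  qed (use assms in auto)
  then show ?thesis by simp
qed

lemma distributed_contact_angle:
  "distributed M lborel \<theta> (\<lambda>t. ennreal (indicator {0..pi} t * contact_angle_pdf N_L t))"
proof -
  \<comment> \<open>The distribution function on the whole line; beyond pi it keeps the value 1,
    because 1 + cos pi = 0 and \<open>N_L\<close> is positive.\<close>
  define g where "g = (\<lambda>a::real. if a < 0 then 0 else 1 - ((1 + cos (min a pi)) / 2) ^ N_L)"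
  show ?thesis
  proof (rule distributedI_borel_atMost[where g = g])
    fix a :: real
    show "(\<integral>\<^sup>+t. ennreal (indicator {0..pi} t * contact_angle_pdf N_L t * indicator {..a} t) \<partial>lborel) = ennreal (g a)"
    proof (cases "a < 0")
      case True
      have "(\<integral>\<^sup>+t. ennreal (indicator {0..pi} t * contact_angle_pdf N_L t * indicator {..a} t) \<partial>lborel) = (\<integral>\<^sup>+t. 0 \<partial>(lborel :: real measure))"
        using True by (intro nn_integral_cong) (auto simp: indicator_def)
      then show ?thesis using True by (simp add: g_def)
    next
      case False
      then have "(\<integral>\<^sup>+t. ennreal (indicator {0..pi} t * contact_angle_pdf N_L t * indicator {..a} t) \<partial>lborel) =
          (\<integral>\<^sup>+t. ennreal (contact_angle_pdf N_L t) * indicator {0..min a pi} t \<partial>lborel)"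
        by (intro nn_integral_cong) (auto simp: indicator_def)
      then show ?thesis using False nn_integral_contact_angle_pdf[of "min a pi"] by (simp add: g_def)
    qed
    show "emeasure M {\<omega> \<in> space M. \<theta> \<omega> \<le> a} = ennreal (g a)"
    proof (cases "a < 0")
      case True
      then have "{\<omega> \<in> space M. \<theta> \<omega> \<le> a} = {}" using contact_angle_bounds(1) by (auto simp: not_le intro: less_le_trans)
      then have "emeasure M {\<omega> \<in> space M. \<theta> \<omega> \<le> a} = 0" by (simp only: emeasure_empty)
      then show ?thesis using True by (simp add: g_def)
    next
      case False
      have "{\<omega> \<in> space M. \<theta> \<omega> \<le> a} = space M - {\<omega> \<in> space M. min a pi < \<theta> \<omega>}"
      proof -
        have "\<theta> \<omega> \<le> a \<longleftrightarrow> \<not> min a pi < \<theta> \<omega>" for \<omega>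
          using contact_angle_bounds(2)[of \<omega>] by linarith
        then show ?thesis by blast
      qed
      moreover have "{\<omega> \<in> space M. min a pi < \<theta> \<omega>} \<in> events" by measurable
      ultimately have "prob {\<omega> \<in> space M. \<theta> \<omega> \<le> a} = 1 - prob {\<omega> \<in> space M. min a pi < \<theta> \<omega>}"
        by (simp add: prob_compl)
      then show ?thesis using False prob_contact_angle_greater[of "min a pi"] by (simp add: g_def emeasure_eq_measure)
    qed
  qed (use contact_angle_pdf_nonneg in \<open>auto simp: indicator_def\<close>)
qed

section \<open>Integration against the law of the contact angle, and the four claims\<close>

lemma enn2real_nn_integral_contact_angle:
  assumes [measurable]: "h \<in> borel_measurable borel" and nonneg: "\<And>t. 0 \<le> t \<Longrightarrow> t \<le> pi \<Longrightarrow> 0 \<le> h t"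
    and A[measurable]: "A \<in> sets borel" and sub: "A \<subseteq> {0..pi}"
  shows "enn2real (\<integral>\<^sup>+\<omega>. indicator A (\<theta> \<omega>) * ennreal (h (\<theta> \<omega>)) \<partial>M) = (LBINT t:A. h t * contact_angle_pdf N_L t)"
proof -
  have "(\<integral>\<^sup>+\<omega>. indicator A (\<theta> \<omega>) * ennreal (h (\<theta> \<omega>)) \<partial>M) =
      (\<integral>\<^sup>+t. ennreal (indicator {0..pi} t * contact_angle_pdf N_L t) * (indicator A t * ennreal (h t)) \<partial>lborel)"
    by (rule distributed_nn_integral[OF distributed_contact_angle, symmetric]) measurable
  also have "\<dots> = (\<integral>\<^sup>+t. ennreal (indicator A t * (h t * contact_angle_pdf N_L t)) \<partial>lborel)"
    using sub nonneg contact_angle_pdf_nonneg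
    by (intro nn_integral_cong) (auto simp: indicator_def ennreal_mult[symmetric] mult.commute)
  finally have "enn2real (\<integral>\<^sup>+\<omega>. indicator A (\<theta> \<omega>) * ennreal (h (\<theta> \<omega>)) \<partial>M) =
      enn2real (\<integral>\<^sup>+t. ennreal (indicator A t * (h t * contact_angle_pdf N_L t)) \<partial>lborel)" by simp
  \<comment> \<open>For nonnegative measurable functions the Lebesgue integral is
    \<open>enn2real\<close> of the nonnegative integral in every case, so there is no integrability
    to check.\<close>
  also have "\<dots> = (LBINT t. indicator A t * (h t * contact_angle_pdf N_L t))"
    using sub nonneg contact_angle_pdf_nonneg
    by (intro integral_eq_nn_integral[symmetric] AE_I2) (auto simp: indicator_def)
  finally show ?thesis by (simp add: set_lebesgue_integral_def)
qed

lemma link_outage_nonneg_angle: "0 \<le> t \<Longrightarrow> t \<le> pi \<Longrightarrow> 0 \<le> link_outage j t"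
  using ex_central_angle[OF u_nonzero R_sat_pos] link_outage_nonneg by metis

lemma prob_cluster_outage:
  assumes "0 \<le> \<theta>_max" "\<theta>_max \<le> pi"
  shows "prob {\<omega> \<in> space M. \<theta> \<omega> \<le> \<theta>_max \<and> (\<forall>j\<in>{0..N_F}. snr (\<xi> j) (W j \<omega>) (dist u (serving j \<omega>)) < \<gamma>)} =
    (LBINT t=0..ereal \<theta>_max. (\<Prod>j\<in>{0..N_F}. link_outage j t) * contact_angle_pdf N_L t)"
proof -
  have "{\<omega> \<in> space M. \<theta> \<omega> \<le> \<theta>_max \<and> (\<forall>j\<in>{0..N_F}. snr (\<xi> j) (W j \<omega>) (dist u (serving j \<omega>)) < \<gamma>)} =
      {\<omega> \<in> space M. \<theta> \<omega> \<in> {0..\<theta>_max} \<and> (\<forall>j\<in>{0..N_F}. snr (\<xi> j) (W j \<omega>) (dist u (serving j \<omega>)) < \<gamma>)}"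
    using contact_angle_bounds(1) by auto
  then have "prob {\<omega> \<in> space M. \<theta> \<omega> \<le> \<theta>_max \<and> (\<forall>j\<in>{0..N_F}. snr (\<xi> j) (W j \<omega>) (dist u (serving j \<omega>)) < \<gamma>)} =
      enn2real (\<integral>\<^sup>+\<omega>. indicator {0..\<theta>_max} (\<theta> \<omega>) * (\<Prod>j\<in>{0..N_F}. ennreal (link_outage j (\<theta> \<omega>))) \<partial>M)"
    using emeasure_outage[of "{0..N_F}" "{0..\<theta>_max}"] by (simp only: measure_def) simp
  also have "\<dots> = enn2real (\<integral>\<^sup>+\<omega>. indicator {0..\<theta>_max} (\<theta> \<omega>) * ennreal (\<Prod>j\<in>{0..N_F}. link_outage j (\<theta> \<omega>)) \<partial>M)"
    using link_outage_nonneg_angle contact_angle_bounds by (simp add: prod_ennreal)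
  also have "\<dots> = (LBINT t:{0..\<theta>_max}. (\<Prod>j\<in>{0..N_F}. link_outage j t) * contact_angle_pdf N_L t)"
    using assms by (intro enn2real_nn_integral_contact_angle) (auto intro!: prod_nonneg link_outage_nonneg_angle)
  also have "\<dots> = (LBINT t=0..ereal \<theta>_max. (\<Prod>j\<in>{0..N_F}. link_outage j t) * contact_angle_pdf N_L t)"
    unfolding zero_ereal_def using assms by (subst interval_integral_Icc) auto
  finally show ?thesis .
qed

lemma prob_contact_angle:
  assumes "A \<in> sets borel" "A \<subseteq> {0..pi}"
  shows "prob {\<omega> \<in> space M. \<theta> \<omega> \<in> A} = (LBINT t:A. contact_angle_pdf N_L t)"
proof -
  \<comment> \<open>The empty set of links leaves the constraint on the contact angle alone.\<close>
  have "prob {\<omega> \<in> space M. \<theta> \<omega> \<in> A} = enn2real (\<integral>\<^sup>+\<omega>. indicator A (\<theta> \<omega>) * ennreal 1 \<partial>M)"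
    using emeasure_outage[of "{}" A] assms(1) by (simp add: measure_def)
  also have "\<dots> = (LBINT t:A. 1 * contact_angle_pdf N_L t)"
    using assms by (intro enn2real_nn_integral_contact_angle) auto
  finally show ?thesis by simp
qed

text \<open>The outage identity for the set {j}, valid for every Borel set of contact angles, is the
  characterising property of the conditional probability.\<close>

lemma cond_prob_link_outage:
  assumes j: "j \<in> {0..N_F}"
  shows "AE \<omega> in M. cond_prob_rv M borel \<theta> {\<omega>' \<in> space M. snr (\<xi> j) (W j \<omega>') (dist u (serving j \<omega>')) < \<gamma>} \<omega>
    = link_outage j (\<theta> \<omega>)"
proof (rule AE_cond_prob_rvI[where g = "link_outage j"])
  have [measurable]: "W j \<in> borel_measurable M" using j by (rule measurable_W)
  have [measurable]: "(\<lambda>\<omega>. serving j \<omega>) \<in> borel_measurable M"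
    using j measurable_X[of j] by (cases "j = 0") auto
  show "{\<omega>' \<in> space M. snr (\<xi> j) (W j \<omega>') (dist u (serving j \<omega>')) < \<gamma>} \<in> events"
    unfolding snr_def by measurable
  fix B :: "real set" assume B: "B \<in> sets borel"
  have "{\<omega> \<in> {\<omega>' \<in> space M. snr (\<xi> j) (W j \<omega>') (dist u (serving j \<omega>')) < \<gamma>}. \<theta> \<omega> \<in> B} =
    {\<omega> \<in> space M. \<theta> \<omega> \<in> B \<and> (\<forall>i\<in>{j}. snr (\<xi> i) (W i \<omega>) (dist u (serving i \<omega>)) < \<gamma>)}" by auto
  then show "emeasure M {\<omega> \<in> {\<omega>' \<in> space M. snr (\<xi> j) (W j \<omega>') (dist u (serving j \<omega>')) < \<gamma>}. \<theta> \<omega> \<in> B} =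
      (\<integral>\<^sup>+\<omega>. indicator B (\<theta> \<omega>) * ennreal (link_outage j (\<theta> \<omega>)) \<partial>M)"
    using emeasure_outage[of "{j}" B] j B by simp
qed (auto intro: link_outage_nonneg_angle contact_angle_bounds)

end
text \<open>Intersecting the outage event with contact angles up to \<open>\<theta>_max\<close>
  expresses that the contact angle is taken over this range. The density is not renormalised: its
  mass on the range is 1 - ((1 + cos \<theta>_max) / 2) ^ N_L.\<close>

theorem theorem2:
  fixes M :: "'a measure"
    and R_earth h_sat R_sat \<theta>_cap \<theta>_max \<gamma>_th :: real
    and u :: "real^3"
    and N_L N_F :: nat
    and L X :: "nat \<Rightarrow> 'a \<Rightarrow> real^3"
    and W :: "nat \<Rightarrow> 'a \<Rightarrow> real"
    and \<Omega> b0 m \<rho>_L \<rho>_F G_L G_F \<nu>_L \<nu>_F \<zeta> \<sigma> \<xi>_L \<xi>_F :: real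
    and F :: "real \<Rightarrow> real"
  assumes M: "prob_space M"
    and geometry: "R_earth > 0" "h_sat > 0" "R_sat = R_earth + h_sat"
    and user: "u \<in> sphere 0 R_earth"
    and counts: "N_L \<ge> 1" "N_F \<ge> 1"
    and angles: "\<theta>_cap > 0" "\<theta>_max \<ge> 0" "\<theta>_max \<le> arccos (R_earth / R_sat) - \<theta>_cap"
    and leaders_indep: "prob_space.indep_vars M (\<lambda>_. borel) L {1..N_L}"
    and leaders_uniform: "\<And>j. j \<in> {1..N_L} \<Longrightarrow> distr M borel (L j) = uniform_sphere R_sat"
    and followers: "cond_iid_given M (\<Pi>\<^sub>M j\<in>{1..N_L}. borel) (leader_positions N_L L) {1..N_F} X
                      (\<lambda>\<omega>. uniform_cap R_sat (associated_leader N_L L u \<omega>) \<theta>_cap)"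
    and fading_params: "\<Omega> > 0" "b0 > 0" "m > 0"
    and F: "F = shadowed_rician_cdf \<Omega> b0 m"
    and fading_indep: "prob_space.indep_vars M (\<lambda>_. borel) W {0..N_F}"
    and fading_nonneg: "\<And>i \<omega>. i \<in> {0..N_F} \<Longrightarrow> \<omega> \<in> space M \<Longrightarrow> W i \<omega> \<ge> 0"
    and fading_cdf: "\<And>i w. i \<in> {0..N_F} \<Longrightarrow> w \<ge> 0 \<Longrightarrow> cdf (distr M borel (W i)) w = F w"
    and fading_indep_positions:
      "indep_rvs M
         (\<Pi>\<^sub>M i\<in>{0..N_F}. borel) (\<lambda>\<omega>. \<lambda>i\<in>{0..N_F}. W i \<omega>)
         ((\<Pi>\<^sub>M j\<in>{1..N_L}. borel) \<Otimes>\<^sub>M (\<Pi>\<^sub>M i\<in>{1..N_F}. borel))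
         (\<lambda>\<omega>. (leader_positions N_L L \<omega>, \<lambda>i\<in>{1..N_F}. X i \<omega>))"
    and link_params: "\<rho>_L > 0" "\<rho>_F > 0" "G_L > 0" "G_F > 0" "\<nu>_L > 0" "\<nu>_F > 0" "\<zeta> > 0" "\<sigma> > 0"
    and link_consts: "\<xi>_L = link_const \<rho>_L G_L \<zeta> \<nu>_L \<sigma>" "\<xi>_F = link_const \<rho>_F G_F \<zeta> \<nu>_F \<sigma>"
    and threshold: "\<gamma>_th > 0"
  shows
    "let \<theta>_LU = contact_angle N_L L u;
         SNR_LU = (\<lambda>\<omega>. snr \<xi>_L (W 0 \<omega>) (dist u (associated_leader N_L L u \<omega>)));
         SNR_FU = (\<lambda>i \<omega>. snr \<xi>_F (W i \<omega>) (dist u (X i \<omega>)));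
         P_LU = P_Cond_LU F \<gamma>_th \<xi>_L R_earth R_sat;
         P_FU = P_out_FU F \<gamma>_th \<xi>_F R_earth R_sat \<theta>_cap;
         f = contact_angle_pdf N_L
     in
       measure M {\<omega> \<in> space M. \<theta>_LU \<omega> \<le> \<theta>_max \<and> SNR_LU \<omega> < \<gamma>_th \<and> (\<forall>i\<in>{1..N_F}. SNR_FU i \<omega> < \<gamma>_th)}
         = (LBINT \<theta>=0..\<theta>_max. P_FU \<theta> ^ N_F * P_LU \<theta> * f \<theta>) \<and>
       (\<forall>A\<in>sets borel. A \<subseteq> {0..\<theta>_max} \<longrightarrow>
          measure M {\<omega> \<in> space M. \<theta>_LU \<omega> \<in> A} = (LBINT \<theta>:A. f \<theta>)) \<and>
       (AE \<omega> in M. \<theta>_LU \<omega> \<le> \<theta>_max \<longrightarrow>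
          cond_prob_rv M borel \<theta>_LU {\<omega>' \<in> space M. SNR_LU \<omega>' < \<gamma>_th} \<omega> = P_LU (\<theta>_LU \<omega>)) \<and>
       (\<forall>i\<in>{1..N_F}. AE \<omega> in M. \<theta>_LU \<omega> \<le> \<theta>_max \<longrightarrow>
          cond_prob_rv M borel \<theta>_LU {\<omega>' \<in> space M. SNR_FU i \<omega>' < \<gamma>_th} \<omega> = P_FU (\<theta>_LU \<omega>))"
proof -
  define \<xi> where "\<xi> j = (if j = 0 then \<xi>_L else \<xi>_F)" for j :: nat
  have R_sat: "R_earth < R_sat" using geometry by simp
  have "0 \<le> R_earth / R_sat" "R_earth / R_sat \<le> 1" using geometry(1) R_sat by simp_all
  \<comment> \<open>Since the sum of the two angles is at most this \<open>arccos\<close>, each of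
    them stays within the range [0, pi] of polar angles.\<close>
  then have "arccos (R_earth / R_sat) \<le> pi"
    using arccos_bounded[of "R_earth / R_sat"] by linarith
  then have \<theta>_bounds: "\<theta>_cap \<le> pi" "\<theta>_max \<le> pi" using angles by linarith+
  have \<xi>_pos: "0 < \<xi> j" for j using link_params by (simp add: \<xi>_def link_consts link_const_def)
  interpret satellite_cluster M R_earth R_sat \<theta>_cap \<gamma>_th u N_L N_F L X W \<xi> F
  proof (intro satellite_cluster.intro satellite_cluster_axioms.intro M)
    show "norm u = R_earth" using user by simp
    show "continuous_on {0..} F" unfolding F using fading_params by (rule continuous_on_shadowed_rician_cdf)
  qed (use geometry(1) R_sat counts angles(1) \<theta>_bounds leaders_indep leaders_uniform followers fading_indep
      fading_cdf fading_indep_positions threshold \<xi>_pos in auto)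
  let ?P_LU = "P_Cond_LU F \<gamma>_th \<xi>_L R_earth R_sat" and ?P_FU = "P_out_FU F \<gamma>_th \<xi>_F R_earth R_sat \<theta>_cap"
  have split: "{0..N_F} = insert 0 {1..N_F}" by auto
  have link: "link_outage 0 = ?P_LU" "j \<noteq> 0 \<Longrightarrow> link_outage j = ?P_FU" for j
    by (simp_all add: link_outage_def \<xi>_def)
  have prod: "(\<Prod>j\<in>{0..N_F}. link_outage j t) = ?P_FU t ^ N_F * ?P_LU t" for t
    unfolding split by (simp add: link)
  have event: "(\<forall>j\<in>{0..N_F}. snr (\<xi> j) (W j \<omega>) (dist u (serving j \<omega>)) < \<gamma>_th) \<longleftrightarrow>
      snr \<xi>_L (W 0 \<omega>) (dist u (lead \<omega>)) < \<gamma>_th \<and> (\<forall>i\<in>{1..N_F}. snr \<xi>_F (W i \<omega>) (dist u (X i \<omega>)) < \<gamma>_th)" for \<omega>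
    unfolding split by (auto simp: \<xi>_def)
  have "measure M {\<omega> \<in> space M. \<theta> \<omega> \<le> \<theta>_max \<and> snr \<xi>_L (W 0 \<omega>) (dist u (lead \<omega>)) < \<gamma>_th \<and>
        (\<forall>i\<in>{1..N_F}. snr \<xi>_F (W i \<omega>) (dist u (X i \<omega>)) < \<gamma>_th)} =
      (LBINT t=0..ereal \<theta>_max. ?P_FU t ^ N_F * ?P_LU t * contact_angle_pdf N_L t)"
    using prob_cluster_outage[OF angles(2) \<theta>_bounds(2)] unfolding event prod .
  moreover have "\<forall>A\<in>sets borel. A \<subseteq> {0..\<theta>_max} \<longrightarrow>
      measure M {\<omega> \<in> space M. \<theta> \<omega> \<in> A} = (LBINT t:A. contact_angle_pdf N_L t)"
    using prob_contact_angle \<theta>_bounds(2) by (meson atLeastatMost_subset_iff order_refl order_trans)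
  moreover have "AE \<omega> in M. \<theta> \<omega> \<le> \<theta>_max \<longrightarrow>
      cond_prob_rv M borel \<theta> {\<omega>' \<in> space M. snr \<xi>_L (W 0 \<omega>') (dist u (lead \<omega>')) < \<gamma>_th} \<omega> = ?P_LU (\<theta> \<omega>)"
    using cond_prob_link_outage[of 0] by (auto simp: link \<xi>_def elim!: eventually_mono)
  moreover have "\<forall>i\<in>{1..N_F}. AE \<omega> in M. \<theta> \<omega> \<le> \<theta>_max \<longrightarrow>
      cond_prob_rv M borel \<theta> {\<omega>' \<in> space M. snr \<xi>_F (W i \<omega>') (dist u (X i \<omega>')) < \<gamma>_th} \<omega> = ?P_FU (\<theta> \<omega>)"
  proof
    fix i assume "i \<in> {1..N_F}"
    then show "AE \<omega> in M. \<theta> \<omega> \<le> \<theta>_max \<longrightarrow>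
      cond_prob_rv M borel \<theta> {\<omega>' \<in> space M. snr \<xi>_F (W i \<omega>') (dist u (X i \<omega>')) < \<gamma>_th} \<omega> = ?P_FU (\<theta> \<omega>)"
      using cond_prob_link_outage[of i] by (auto simp: link \<xi>_def elim!: eventually_mono)
  qed
  ultimately show ?thesis unfolding Let_def by blast
qed

end
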